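(* Let $E$ be a separable complex Hilbert space and let $\Phi \in L^\infty_{\mathcal{B}(E)}(\mathbb{T})$. Then the operator $$M^{S_E^*}_{S_E^*}(T_\Phi) = \begin{bmatrix} S_E^* & T_\Phi \\ 0 & S_E^* \end{bmatrix}$$ on $H^2_E(\mathbb{D}) \oplus H^2_E(\mathbb{D})$ is similar to a contraction if and only if $\Phi = 0$.
   Context: $\mathcal{B}(H)$ denotes the bounded linear operators on a Hilbert space $H$. An operator $T \in \mathcal{B}(H)$ is a contraction if $\|T\| \le 1$, and is similar to a contraction if there is an invertible $W \in \mathcal{B}(H)$ such that $W^{-1} T W$ is a contraction. $\mathbb{D}$ is the open unit disc in $\mathbb{C}$, $\mathbb{T} = \partial\mathbb{D}$. $L^2_E(\mathbb{T})$ is the $E$-valued $L^2$-space on $\mathbb{T}$ (normalized Lebesgue measure), and $H^2_E(\mathbb{D})$ is the $E$-valued Hardy space, viewed via boundary values as a closed subspace of $L^2_E(\mathbb{T})$. $S_E$ is the shift on $H^2_E(\mathbb{D})$, $(S_E f)(z) = z f(z)$. $L^\infty_{\mathcal{B}(E)}(\mathbb{T})$ is the space of $\mathcal{B}(E)$-valued essentially bounded (weak-operator) measurable functions on $\mathbb{T}$, with functions equal a.e. identified. For $\Phi \in L^\infty_{\mathcal{B}(E)}(\mathbb{T})$, the Toeplitz operator is $T_\Phi = P_{H^2_E(\mathbb{D})} M_\Phi|_{H^2_E(\mathbb{D})}$, where $M_\Phi f = \Phi f$ on $L^2_E(\mathbb{T})$ and $P_{H^2_E(\mathbb{D})}$ is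 the orthogonal projection of $L^2_E(\mathbb{T})$ onto $H^2_E(\mathbb{D})$. *)

theory Defs
  imports "HOL-Probability.Probability_Measure"
begin

section \<open>Complex Hilbert spaces\<close>

text \<open>
  The norm and topology are those of the underlying real inner product space; the complex inner
  product is linear in its first argument and has the real one as its real part.
\<close>

class complex_inner = real_inner +
  fixes scaleC :: "complex \<Rightarrow> 'a \<Rightarrow> 'a" (infixr "*\<^sub>C" 75)
    and cinner :: "'a \<Rightarrow> 'a \<Rightarrow> complex"
  assumes scaleC_add_right: "c *\<^sub>C (x + y) = c *\<^sub>C x + c *\<^sub>C y"
    and scaleC_add_left: "(c + d) *\<^sub>C x = c *\<^sub>C x + d *\<^sub>C x"
    and scaleC_scaleC: "c *\<^sub>C d *\<^sub>C x = (c * d) *\<^sub>C x"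
    and scaleC_of_real: "complex_of_real r *\<^sub>C x = r *\<^sub>R x"
    and cinner_commute: "cinner x y = cnj (cinner y x)"
    and cinner_add_left: "cinner (x + y) z = cinner x z + cinner y z"
    and cinner_scaleC_left: "cinner (c *\<^sub>C x) y = c * cinner x y"
    and Re_cinner: "Re (cinner x y) = inner x y"

class chilbert_space = complex_inner + complete_space

class separable_chilbert = chilbert_space +
  assumes separable: "\<exists>D. countable D \<and> (\<forall>x. \<forall>e>0. \<exists>d\<in>D. dist d x < e)"

instance chilbert_space \<subseteq> banach ..

instance separable_chilbert \<subseteq> second_countable_topology
proof
  obtain D :: "'a set" where D: "countable D" "\<And>x e. e > 0 \<Longrightarrow> \<exists>d\<in>D. dist d x < e"
    using separable by blast
  define B where "B = (\<lambda>(d, n). ball d (inverse (real (Suc n)))) ` (D \<times> (UNIV :: nat set))"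
  have cB: "countable B"
    unfolding B_def using D(1) by (intro countable_image countable_SIGMA) auto
  have "topological_basis B"
  proof (rule topological_basisI)
    show "open b" if "b \<in> B" for b
      using that by (auto simp: B_def)
    show "\<exists>b\<in>B. x \<in> b \<and> b \<subseteq> U" if U: "open U" "x \<in> U" for U and x :: 'a
    proof -
      obtain e where e: "e > 0" "ball x e \<subseteq> U"
        using U open_contains_ball by blast
      obtain n where n: "inverse (real (Suc n)) < e / 2"
        using reals_Archimedean[of "e / 2"] e by auto
      obtain d where d: "d \<in> D" "dist d x < inverse (real (Suc n))"
        using D(2)[of "inverse (real (Suc n))" x] by auto
      have "ball d (inverse (real (Suc n))) \<subseteq> ball x e"
      proof
        fix y assume "y \<in> ball d (inverse (real (Suc n)))"
        then have "dist x y < e"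
          using d(2) n dist_triangle[of x y d] by (auto simp: dist_commute)
        then show "y \<in> ball x e" by simp
      qed
      with e d show ?thesis
        by (intro bexI[of _ "ball d (inverse (real (Suc n)))"]) (auto simp: B_def)
    qed
  qed
  then show "\<exists>B::'a set set. countable B \<and> open = generate_topology B"
    using cB topological_basis_imp_subbasis by blast
qed

instantiation complex :: separable_chilbert
begin
definition "c *\<^sub>C x = c * (x :: complex)"
definition "cinner x y = x * cnj (y :: complex)"
instance
proof
  obtain D :: "complex set" where D: "countable D" "\<And>X. open X \<Longrightarrow> X \<noteq> {} \<Longrightarrow> \<exists>d\<in>D. d \<in> X"
    using countable_dense_setE by blast
  have "\<exists>d\<in>D. dist d x < e" if "e > 0" for x e
    using D(2)[of "ball x e"] that by (auto simp: dist_commute)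
  with D(1) show "\<exists>D :: complex set. countable D \<and> (\<forall>x. \<forall>e>0. \<exists>d\<in>D. dist d x < e)"
    by blast
qed (auto simp: scaleC_complex_def cinner_complex_def algebra_simps scaleR_conv_of_real
      inner_complex_def)
end

lemma scaleC_one [simp]: "1 *\<^sub>C x = (x :: 'a :: complex_inner)"
  using scaleC_of_real[of 1 x] by simp

lemma cinner_self: "cinner x x = complex_of_real ((norm (x :: 'a :: complex_inner))\<^sup>2)"
  using cinner_commute[of x x] Re_cinner[of x x]
  by (auto simp: complex_eq_iff power2_norm_eq_inner)

lemma norm_scaleC [simp]: "norm (c *\<^sub>C x) = cmod c * norm (x :: 'a :: complex_inner)"
proof -
  have "complex_of_real ((norm (c *\<^sub>C x))\<^sup>2) = c * cnj (c * cinner x x)"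
    unfolding cinner_self[symmetric] cinner_scaleC_left
    by (subst cinner_commute) (simp add: cinner_scaleC_left)
  also have "\<dots> = complex_of_real ((cmod c * norm x)\<^sup>2)"
    by (simp add: cinner_self power_mult_distrib complex_norm_square mult_ac del: of_real_power)
  finally have "(norm (c *\<^sub>C x))\<^sup>2 = (cmod c * norm x)\<^sup>2"
    using of_real_eq_iff by blast
  then show ?thesis by simp
qed

lemma bounded_linear_scaleC: "bounded_linear (\<lambda>x :: 'a :: complex_inner. c *\<^sub>C x)"
proof (rule bounded_linear_intro[where K = "cmod c"])
  show "c *\<^sub>C r *\<^sub>R x = r *\<^sub>R c *\<^sub>C x" for r and x :: 'a
    by (simp add: scaleC_of_real[symmetric] scaleC_scaleC mult.commute)
qed (auto simp: scaleC_add_right)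

lemma cinner_add_right: "cinner x (y + z) = cinner x y + cinner x (z :: 'a :: complex_inner)"
  by (metis cinner_add_left cinner_commute complex_cnj_add)

lemma cinner_scaleC_right: "cinner x (c *\<^sub>C y) = cnj c * cinner x (y :: 'a :: complex_inner)"
  by (metis cinner_commute cinner_scaleC_left complex_cnj_mult)

lemma norm_cinner_le: "cmod (cinner x y) \<le> norm x * norm (y :: 'a :: complex_inner)"
proof (cases "cinner x y = 0")
  case False
  define c where "c = cnj (cinner x y) / complex_of_real (cmod (cinner x y))"
  have c: "cmod c = 1" using False by (simp add: c_def norm_divide)
  have "c * cinner x y = complex_of_real (cmod (cinner x y))"
    using False complex_norm_square[of "cinner x y"]
    by (simp add: c_def field_simps power2_eq_square)
  then have "cmod (cinner x y) = inner (c *\<^sub>C x) y"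
    by (simp add: Re_cinner[symmetric] cinner_scaleC_left)
  also have "\<dots> \<le> norm (c *\<^sub>C x) * norm y"
    by (rule norm_cauchy_schwarz)
  finally show ?thesis by (simp add: c)
qed simp

lemma bounded_bilinear_scaleC: "bounded_bilinear (scaleC :: complex \<Rightarrow> 'a \<Rightarrow> 'a :: complex_inner)"
proof
  show "(r *\<^sub>R a) *\<^sub>C b = r *\<^sub>R a *\<^sub>C b" for r a and b :: 'a
    by (simp add: scaleR_conv_of_real scaleC_scaleC[symmetric] scaleC_of_real)
  show "a *\<^sub>C r *\<^sub>R b = r *\<^sub>R a *\<^sub>C b" for r a and b :: 'a
    by (simp add: scaleC_of_real[symmetric] scaleC_scaleC mult.commute)
  show "\<exists>K. \<forall>a (b :: 'a). norm (a *\<^sub>C b) \<le> norm a * norm b * K"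
    by (intro exI[of _ 1]) simp
qed (auto simp: scaleC_add_left scaleC_add_right)

lemma scaleC_zero_right [simp]: "c *\<^sub>C (0 :: 'a :: complex_inner) = 0"
  using bounded_bilinear_scaleC by (rule bounded_bilinear.zero_right)

lemma scaleC_diff_right: "c *\<^sub>C (x - y) = c *\<^sub>C x - c *\<^sub>C (y :: 'a :: complex_inner)"
  using bounded_bilinear_scaleC by (rule bounded_bilinear.diff_right)

lemma bounded_bilinear_cinner:
  "bounded_bilinear (cinner :: 'a :: complex_inner \<Rightarrow> 'a \<Rightarrow> complex)"
proof
  show "cinner (r *\<^sub>R a) b = r *\<^sub>R cinner a b" for r and a b :: 'a
    unfolding scaleC_of_real[symmetric, of r a] by (simp add: cinner_scaleC_left scaleR_conv_of_real)
  show "cinner a (r *\<^sub>R b) = r *\<^sub>R cinner a b" for r and a b :: 'a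
    unfolding scaleC_of_real[symmetric, of r b] by (simp add: cinner_scaleC_right scaleR_conv_of_real)
  show "\<exists>K. \<forall>a b :: 'a. norm (cinner a b) \<le> norm a * norm b * K"
    by (intro exI[of _ 1]) (simp add: norm_cinner_le)
qed (auto simp: cinner_add_left cinner_add_right)

instantiation prod :: (complex_inner, complex_inner) complex_inner
begin
definition "c *\<^sub>C x = (c *\<^sub>C fst x, c *\<^sub>C snd x)"
definition "cinner x y = cinner (fst x) (fst y) + cinner (snd x) (snd y)"
instance
  by standard
     (auto simp: scaleC_prod_def cinner_prod_def scaleC_add_right scaleC_add_left scaleC_scaleC
        scaleC_of_real prod_eq_iff cinner_add_left cinner_scaleC_left Re_cinner inner_prod_def
        distrib_left intro: cinner_commute
        simp flip: cinner_commute)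
end


definition bounded_clinear :: "('a :: complex_inner \<Rightarrow> 'b :: complex_inner) \<Rightarrow> bool" where
  "bounded_clinear T \<longleftrightarrow> bounded_linear T \<and> (\<forall>c x. T (c *\<^sub>C x) = c *\<^sub>C T x)"

definition contraction :: "('a :: complex_inner \<Rightarrow> 'a) \<Rightarrow> bool" where
  "contraction T \<longleftrightarrow> bounded_clinear T \<and> onorm T \<le> 1"

definition similar_to_contraction :: "('a :: complex_inner \<Rightarrow> 'a) \<Rightarrow> bool" where
  "similar_to_contraction T \<longleftrightarrow>
     (\<exists>W V :: 'a \<Rightarrow> 'a. bounded_clinear W \<and> bounded_clinear V \<and> W \<circ> V = id \<and> V \<circ> W = id \<and>
            contraction (V \<circ> T \<circ> W))"

definition cadjoint :: "('a :: complex_inner \<Rightarrow> 'b :: complex_inner) \<Rightarrow> 'b \<Rightarrow> 'a" where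
  "cadjoint T = (THE T'. \<forall>x y. cinner (T x) y = cinner x (T' y))"

text \<open>
  The next operator is the orthogonal projection onto \<open>S\<close> whenever it exists, in particular
  for closed subspaces of a Hilbert space.
\<close>

definition orth_proj :: "'a :: complex_inner set \<Rightarrow> 'a \<Rightarrow> 'a" where
  "orth_proj S x = (THE p. p \<in> S \<and> (\<forall>s\<in>S. cinner (x - p) s = 0))"

definition block_upper ::
  "('a :: complex_inner \<Rightarrow> 'a) \<Rightarrow> ('b :: complex_inner \<Rightarrow> 'a) \<Rightarrow> ('b \<Rightarrow> 'b) \<Rightarrow> 'a \<times> 'b \<Rightarrow> 'a \<times> 'b" where
  "block_upper A X B = (\<lambda>(f, g). (A f + X g, B g))"


section \<open>The space of square integrable functions on the circle\<close>

text \<open>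
  Normalized arc length. The underlying space is the unit circle itself, so values of functions off
  the circle are irrelevant to measurability, integrals and almost-everywhere statements.
\<close>

definition circle :: "complex measure" where
  "circle = distr (uniform_measure lborel {0..2 * pi}) (restrict_space borel (sphere 0 1)) cis"

lemma prob_space_circle: "prob_space circle"
  proof -
  have "cis \<in> borel_measurable borel"
    by (intro borel_measurable_continuous_onI continuous_intros)
  then have "cis \<in> uniform_measure lborel {0..2 * pi} \<rightarrow>\<^sub>M restrict_space borel (sphere 0 1)"
    by (intro measurable_restrict_space2) auto
  then show ?thesis
    unfolding circle_def by (intro prob_space.prob_space_distr prob_space_uniform_measure) auto
qed

lemma space_circle [simp]: "space circle = sphere 0 1"
  by (simp add: circle_def space_restrict_space)

lemma sets_circle [measurable_cong]: "sets circle = sets (restrict_space borel (sphere 0 1))"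
  by (simp add: circle_def)

definition L2_fun :: "(complex \<Rightarrow> 'e :: separable_chilbert) set" where
  "L2_fun = {f \<in> borel_measurable circle. integrable circle (\<lambda>\<zeta>. (norm (f \<zeta>))\<^sup>2)}"

lemma L2_fun_zero: "(\<lambda>_. 0) \<in> L2_fun"
  by (simp add: L2_fun_def)

quotient_type (overloaded) 'e L2 =
  "complex \<Rightarrow> 'e :: separable_chilbert" / partial:
  "\<lambda>f g. f \<in> L2_fun \<and> g \<in> L2_fun \<and> (AE \<zeta> in circle. f \<zeta> = g \<zeta>)"
proof (rule part_equivpI)
  show "\<exists>f::complex \<Rightarrow> 'e. f \<in> L2_fun \<and> f \<in> L2_fun \<and> (AE \<zeta> in circle. f \<zeta> = f \<zeta>)"
    using L2_fun_zero by (intro exI[of _ "\<lambda>_. 0"]) auto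
  show "symp (\<lambda>f g :: complex \<Rightarrow> 'e. f \<in> L2_fun \<and> g \<in> L2_fun \<and> (AE \<zeta> in circle. f \<zeta> = g \<zeta>))"
    by (intro sympI) (auto elim: eventually_mono)
  show "transp (\<lambda>f g :: complex \<Rightarrow> 'e. f \<in> L2_fun \<and> g \<in> L2_fun \<and> (AE \<zeta> in circle. f \<zeta> = g \<zeta>))"
    by (intro transpI) auto
qed

lemma L2_fun_add:
  assumes "f \<in> L2_fun" "g \<in> L2_fun"
  shows "(\<lambda>\<zeta>. f \<zeta> + g \<zeta>) \<in> L2_fun"
proof -
  have [measurable]: "f \<in> borel_measurable circle" "g \<in> borel_measurable circle"
    using assms by (auto simp: L2_fun_def)
  have "integrable circle (\<lambda>\<zeta>. 2 * (norm (f \<zeta>))\<^sup>2 + 2 * (norm (g \<zeta>))\<^sup>2)"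
    using assms by (auto simp: L2_fun_def)
  then have "integrable circle (\<lambda>\<zeta>. (norm (f \<zeta> + g \<zeta>))\<^sup>2)"
  proof (rule Bochner_Integration.integrable_bound)
    show "AE \<zeta> in circle. norm ((norm (f \<zeta> + g \<zeta>))\<^sup>2)
        \<le> norm (2 * (norm (f \<zeta>))\<^sup>2 + 2 * (norm (g \<zeta>))\<^sup>2)"
    proof (rule AE_I2)
      fix \<zeta>
      have "(norm (f \<zeta> + g \<zeta>))\<^sup>2 \<le> (norm (f \<zeta>) + norm (g \<zeta>))\<^sup>2"
        by (intro power_mono norm_triangle_ineq) auto
      also have "\<dots> \<le> 2 * (norm (f \<zeta>))\<^sup>2 + 2 * (norm (g \<zeta>))\<^sup>2"
        using sum_squares_bound[of "norm (f \<zeta>)" "norm (g \<zeta>)"] by (simp add: power2_sum)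
      finally show "norm ((norm (f \<zeta> + g \<zeta>))\<^sup>2)
        \<le> norm (2 * (norm (f \<zeta>))\<^sup>2 + 2 * (norm (g \<zeta>))\<^sup>2)" by simp
    qed
  qed measurable
  then show ?thesis by (simp add: L2_fun_def)
qed

lemma borel_measurable_scaleC [measurable]:
  fixes f :: "'a \<Rightarrow> 'e :: separable_chilbert"
  assumes [measurable]: "c \<in> borel_measurable M" "f \<in> borel_measurable M"
  shows "(\<lambda>x. c x *\<^sub>C f x) \<in> borel_measurable M"
  by (rule borel_measurable_continuous_Pair[OF assms])
     (intro bounded_bilinear.continuous_on[OF bounded_bilinear_scaleC] continuous_intros)

lemma borel_measurable_cinner [measurable]:
  fixes f :: "'a \<Rightarrow> 'e :: separable_chilbert"
  assumes [measurable]: "f \<in> borel_measurable M" "g \<in> borel_measurable M"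
  shows "(\<lambda>x. cinner (f x) (g x)) \<in> borel_measurable M"
  by (rule borel_measurable_continuous_Pair[OF assms])
     (intro bounded_bilinear.continuous_on[OF bounded_bilinear_cinner] continuous_intros)

lemma borel_measurable_weak:
  fixes h :: "'a \<Rightarrow> 'e :: separable_chilbert"
  assumes weak: "\<And>y. (\<lambda>x. cinner (h x) y) \<in> borel_measurable M"
  shows "h \<in> borel_measurable M"
proof -
  obtain D :: "'e set" where D: "countable D" "\<And>X. open X \<Longrightarrow> X \<noteq> {} \<Longrightarrow> \<exists>d\<in>D. d \<in> X"
    using countable_dense_setE by blast
  have wr: "(\<lambda>x. inner (h x) y) \<in> borel_measurable M" for y
    unfolding Re_cinner[symmetric] using weak[of y] by measurable
  have cb: "{x \<in> space M. h x \<in> cball c e} \<in> sets M" for c e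
  proof -
    have iff: "v \<in> cball c e \<longleftrightarrow> (\<forall>d\<in>D. inner (v - c) d \<le> e * norm d)" if "e \<ge> 0" for v
    proof
      assume "v \<in> cball c e"
      then have ve: "norm (v - c) \<le> e" by (simp add: dist_norm norm_minus_commute)
      show "\<forall>d\<in>D. inner (v - c) d \<le> e * norm d"
      proof
        fix d assume "d \<in> D"
        have "inner (v - c) d \<le> norm (v - c) * norm d" by (rule norm_cauchy_schwarz)
        also have "\<dots> \<le> e * norm d" using ve by (intro mult_right_mono) auto
        finally show "inner (v - c) d \<le> e * norm d" .
      qed
    next
      assume R: "\<forall>d\<in>D. inner (v - c) d \<le> e * norm d"
      have "inner (v - c) w \<le> e * norm w" for w
      proof (rule ccontr)
        assume "\<not> ?thesis"
        then have "w \<in> {w. e * norm w < inner (v - c) w}" by simp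
        moreover have "open {w. e * norm w < inner (v - c) w}"
          by (intro open_Collect_less continuous_intros)
        ultimately obtain d where "d \<in> D" "e * norm d < inner (v - c) d"
          using D(2)[of "{w. e * norm w < inner (v - c) w}"] by blast
        with R show False by force
      qed
      from this[of "v - c"] have "norm (v - c) * norm (v - c) \<le> e * norm (v - c)"
        by (simp add: power2_norm_eq_inner[symmetric] power2_eq_square)
      then have "norm (v - c) \<le> e"
        using that by (cases "v = c") auto
      then show "v \<in> cball c e" by (simp add: dist_norm norm_minus_commute)
    qed
    show ?thesis
    proof (cases "e \<ge> 0")
      case True
      have "{x \<in> space M. \<forall>d\<in>D. inner (h x) d - inner c d \<le> e * norm d} \<in> sets M"
        using wr D(1) by (intro sets.sets_Collect_countable_All' borel_measurable_le) auto
      with True show ?thesis by (simp only: iff inner_diff_left)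
    qed simp
  qed
  have ball: "{x \<in> space M. h x \<in> ball c e} \<in> sets M" for c e
  proof -
    have "{x \<in> space M. h x \<in> ball c e} = (\<Union>n. {x \<in> space M. h x \<in> cball c (e - inverse (real (Suc n)))})"
    proof safe
      fix x assume "x \<in> space M" "h x \<in> ball c e"
      then obtain n where "inverse (real (Suc n)) < e - dist c (h x)"
        using reals_Archimedean[of "e - dist c (h x)"] by auto
      with \<open>x \<in> space M\<close> show "x \<in> (\<Union>n. {x \<in> space M. h x \<in> cball c (e - inverse (real (Suc n)))})"
        by (intro UN_I[of n]) auto
    next
      fix x n assume "h x \<in> cball c (e - inverse (real (Suc n)))"
      moreover have "inverse (real (Suc n)) > 0" by simp
      ultimately show "h x \<in> ball c e" unfolding mem_ball mem_cball by linarith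
    qed
    then show ?thesis using cb by auto
  qed
  show ?thesis
  proof (rule borel_measurableI)
    fix U :: "'e set" assume U: "open U"
    define B where "B = {(d, n). d \<in> D \<and> ball d (inverse (real (Suc n))) \<subseteq> U}"
    have "countable B"
      by (rule countable_subset[of _ "D \<times> UNIV"]) (auto simp: B_def D(1))
    have "U = (\<Union>(d, n)\<in>B. ball d (inverse (real (Suc n))))"
    proof safe
      fix x assume "x \<in> U"
      then obtain e where e: "e > 0" "ball x e \<subseteq> U"
        using U open_contains_ball by blast
      obtain n where n: "inverse (real (Suc n)) < e / 2"
        using reals_Archimedean[of "e / 2"] e by auto
      obtain d where d: "d \<in> D" "dist x d < inverse (real (Suc n))"
        using D(2)[of "ball x (inverse (real (Suc n)))"] by auto
      have "ball d (inverse (real (Suc n))) \<subseteq> ball x e"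
      proof
        fix y assume "y \<in> ball d (inverse (real (Suc n)))"
        then have "dist x y < e"
          using d(2) n dist_triangle[of x y d] by (auto simp: dist_commute)
        then show "y \<in> ball x e" by simp
      qed
      with e d show "x \<in> (\<Union>(d, n)\<in>B. ball d (inverse (real (Suc n))))"
        by (intro UN_I[of "(d, n)"]) (auto simp: B_def dist_commute)
    qed (auto simp: B_def)
    then have "h -` U \<inter> space M = (\<Union>(d, n)\<in>B. {x \<in> space M. h x \<in> ball d (inverse (real (Suc n)))})"
      by (simp only: vimage_def Int_def) blast
    also have "\<dots> \<in> sets M"
      using \<open>countable B\<close> ball by (intro sets.countable_UN') auto
    finally show "h -` U \<inter> space M \<in> sets M" .
  qed
qed

lemma L2_fun_scaleC_bounded:
  fixes f :: "complex \<Rightarrow> 'e :: separable_chilbert"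
  assumes f: "f \<in> L2_fun" and [measurable]: "c \<in> borel_measurable circle"
    and c: "\<And>\<zeta>. \<zeta> \<in> sphere 0 1 \<Longrightarrow> cmod (c \<zeta>) \<le> K"
  shows "(\<lambda>\<zeta>. c \<zeta> *\<^sub>C f \<zeta>) \<in> L2_fun"
proof -
  have [measurable]: "f \<in> borel_measurable circle"
    using f by (auto simp: L2_fun_def)
  have "integrable circle (\<lambda>\<zeta>. K\<^sup>2 * (norm (f \<zeta>))\<^sup>2)"
    using f by (auto simp: L2_fun_def)
  then have "integrable circle (\<lambda>\<zeta>. (norm (c \<zeta> *\<^sub>C f \<zeta>))\<^sup>2)"
  proof (rule Bochner_Integration.integrable_bound)
    show "AE \<zeta> in circle. norm ((norm (c \<zeta> *\<^sub>C f \<zeta>))\<^sup>2) \<le> norm (K\<^sup>2 * (norm (f \<zeta>))\<^sup>2)"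
      using c by (intro AE_I2) (auto simp: power_mult_distrib intro!: mult_right_mono power_mono)
  qed measurable
  then show ?thesis by (simp add: L2_fun_def)
qed

lemma L2_fun_scaleC: "f \<in> L2_fun \<Longrightarrow> (\<lambda>\<zeta>. c *\<^sub>C f \<zeta>) \<in> L2_fun"
  by (rule L2_fun_scaleC_bounded[where K = "cmod c"]) auto

lemma L2_fun_scaleR: "f \<in> L2_fun \<Longrightarrow> (\<lambda>\<zeta>. c *\<^sub>R f \<zeta>) \<in> L2_fun"
  using L2_fun_scaleC[of f "complex_of_real c"] by (simp add: scaleC_of_real)

lemma L2_fun_minus: "f \<in> L2_fun \<Longrightarrow> (\<lambda>\<zeta>. - f \<zeta>) \<in> L2_fun"
  using L2_fun_scaleR[of f "- 1"] by simp

lemma L2_fun_diff: "f \<in> L2_fun \<Longrightarrow> g \<in> L2_fun \<Longrightarrow> (\<lambda>\<zeta>. f \<zeta> - g \<zeta>) \<in> L2_fun"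
  using L2_fun_add[of f "\<lambda>\<zeta>. - g \<zeta>"] L2_fun_minus[of g] by simp

lemma integrable_cinner:
  assumes "f \<in> L2_fun" "g \<in> L2_fun"
  shows "integrable circle (\<lambda>\<zeta>. cinner (f \<zeta>) (g \<zeta>))"
proof -
  have [measurable]: "f \<in> borel_measurable circle" "g \<in> borel_measurable circle"
    using assms by (auto simp: L2_fun_def)
  have "integrable circle (\<lambda>\<zeta>. (norm (f \<zeta>))\<^sup>2 + (norm (g \<zeta>))\<^sup>2)"
    using assms by (auto simp: L2_fun_def)
  then show ?thesis
  proof (rule Bochner_Integration.integrable_bound)
    show "AE \<zeta> in circle. norm (cinner (f \<zeta>) (g \<zeta>)) \<le> norm ((norm (f \<zeta>))\<^sup>2 + (norm (g \<zeta>))\<^sup>2)"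
    proof (rule AE_I2)
      fix \<zeta>
      have "norm (cinner (f \<zeta>) (g \<zeta>)) \<le> norm (f \<zeta>) * norm (g \<zeta>)"
        by (rule norm_cinner_le)
      also have "\<dots> \<le> 2 * norm (f \<zeta>) * norm (g \<zeta>)"
        by simp
      also have "\<dots> \<le> (norm (f \<zeta>))\<^sup>2 + (norm (g \<zeta>))\<^sup>2"
        by (rule sum_squares_bound)
      finally show "norm (cinner (f \<zeta>) (g \<zeta>)) \<le> norm ((norm (f \<zeta>))\<^sup>2 + (norm (g \<zeta>))\<^sup>2)"
        by simp
    qed
  qed measurable
qed

lemma integrable_inner:
  assumes "f \<in> L2_fun" "g \<in> L2_fun"
  shows "integrable circle (\<lambda>\<zeta>. inner (f \<zeta>) (g \<zeta>))"
  using integrable_Re[OF integrable_cinner[OF assms]] by (simp add: Re_cinner)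

instantiation L2 :: (separable_chilbert) complex_inner
begin

lift_definition zero_L2 :: "'a L2" is "\<lambda>_. 0"
  by (simp add: L2_fun_zero)

lift_definition plus_L2 :: "'a L2 \<Rightarrow> 'a L2 \<Rightarrow> 'a L2" is "\<lambda>f g \<zeta>. f \<zeta> + g \<zeta>"
  by (auto intro: L2_fun_add)

lift_definition minus_L2 :: "'a L2 \<Rightarrow> 'a L2 \<Rightarrow> 'a L2" is "\<lambda>f g \<zeta>. f \<zeta> - g \<zeta>"
  by (auto intro: L2_fun_diff)

lift_definition uminus_L2 :: "'a L2 \<Rightarrow> 'a L2" is "\<lambda>f \<zeta>. - f \<zeta>"
  by (auto intro: L2_fun_minus)

lift_definition scaleR_L2 :: "real \<Rightarrow> 'a L2 \<Rightarrow> 'a L2" is "\<lambda>r f \<zeta>. r *\<^sub>R f \<zeta>"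
  by (auto intro: L2_fun_scaleR)

lift_definition scaleC_L2 :: "complex \<Rightarrow> 'a L2 \<Rightarrow> 'a L2" is "\<lambda>c f \<zeta>. c *\<^sub>C f \<zeta>"
  by (auto intro: L2_fun_scaleC)

lift_definition cinner_L2 :: "'a L2 \<Rightarrow> 'a L2 \<Rightarrow> complex"
  is "\<lambda>f g. \<integral>\<zeta>. cinner (f \<zeta>) (g \<zeta>) \<partial>circle"
  by (intro integral_cong_AE) (auto simp: L2_fun_def)

lift_definition inner_L2 :: "'a L2 \<Rightarrow> 'a L2 \<Rightarrow> real"
  is "\<lambda>f g. \<integral>\<zeta>. inner (f \<zeta>) (g \<zeta>) \<partial>circle"
  by (intro integral_cong_AE) (auto simp: L2_fun_def)

definition norm_L2 :: "'a L2 \<Rightarrow> real" where "norm_L2 f = sqrt (inner f f)"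
definition dist_L2 :: "'a L2 \<Rightarrow> 'a L2 \<Rightarrow> real" where "dist_L2 f g = norm (f - g)"
definition sgn_L2 :: "'a L2 \<Rightarrow> 'a L2" where "sgn_L2 f = inverse (norm f) *\<^sub>R f"
definition uniformity_L2 :: "('a L2 \<times> 'a L2) filter" where
  "uniformity_L2 = (INF e\<in>{0<..}. principal {(f, g). dist f g < e})"
definition open_L2 :: "'a L2 set \<Rightarrow> bool" where
  "open_L2 U \<longleftrightarrow> (\<forall>x\<in>U. eventually (\<lambda>(x', y). x' = x \<longrightarrow> y \<in> U) uniformity)"

instance
proof
  fix f g h :: "'a L2" and r s :: real and c d :: complex
  show "f + g + h = f + (g + h)" by transfer (auto simp: add.assoc intro!: L2_fun_add)
  show "f + g = g + f" by transfer (auto simp: add.commute intro!: L2_fun_add)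
  show "0 + f = f" by transfer auto
  show "- f + f = 0" by transfer (auto simp: L2_fun_zero)
  show "f - g = f + - g" by transfer (auto simp: L2_fun_add L2_fun_diff L2_fun_minus)
  show "r *\<^sub>R (f + g) = r *\<^sub>R f + r *\<^sub>R g"
    by transfer (auto simp: scaleR_add_right intro!: L2_fun_add L2_fun_scaleR)
  show "(r + s) *\<^sub>R f = r *\<^sub>R f + s *\<^sub>R f"
    by transfer (auto simp: scaleR_add_left intro!: L2_fun_add L2_fun_scaleR)
  show "r *\<^sub>R s *\<^sub>R f = (r * s) *\<^sub>R f"
    by transfer (auto intro!: L2_fun_scaleR)
  show "1 *\<^sub>R f = f" by transfer auto
  show "c *\<^sub>C (f + g) = c *\<^sub>C f + c *\<^sub>C g"
    by transfer (auto simp: scaleC_add_right intro!: L2_fun_add L2_fun_scaleC)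
  show "(c + d) *\<^sub>C f = c *\<^sub>C f + d *\<^sub>C f"
    by transfer (auto simp: scaleC_add_left intro!: L2_fun_add L2_fun_scaleC)
  show "c *\<^sub>C d *\<^sub>C f = (c * d) *\<^sub>C f"
    by transfer (auto simp: scaleC_scaleC intro!: L2_fun_scaleC)
  show "complex_of_real r *\<^sub>C f = r *\<^sub>R f"
    by transfer (auto simp: scaleC_of_real intro!: L2_fun_scaleR)
  show "dist f g = norm (f - g)" by (rule dist_L2_def)
  show "sgn f = inverse (norm f) *\<^sub>R f" by (rule sgn_L2_def)
  show "uniformity = (INF e\<in>{0<..}. principal {(f, g :: 'a L2). dist f g < e})"
    by (rule uniformity_L2_def)
  show "open U = (\<forall>x\<in>U. \<forall>\<^sub>F (x', y) in uniformity. x' = x \<longrightarrow> y \<in> U)" for U :: "'a L2 set"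
    by (rule open_L2_def)
  show "inner f g = inner g f" by transfer (simp add: inner_commute)
  show "inner (f + g) h = inner f h + inner g h"
    by transfer (simp add: inner_add_left integrable_inner)
  show "inner (r *\<^sub>R f) g = r * inner f g" by transfer simp
  show "0 \<le> inner f f" by transfer simp
  show "inner f f = 0 \<longleftrightarrow> f = 0"
  proof transfer
    fix f :: "complex \<Rightarrow> 'a"
    assume "f \<in> L2_fun \<and> f \<in> L2_fun \<and> (AE \<zeta> in circle. f \<zeta> = f \<zeta>)"
    then have f: "f \<in> L2_fun" by simp
    show "(\<integral>\<zeta>. inner (f \<zeta>) (f \<zeta>) \<partial>circle) = 0 \<longleftrightarrow>
        f \<in> L2_fun \<and> (\<lambda>_. 0) \<in> L2_fun \<and> (AE \<zeta> in circle. f \<zeta> = 0)"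
      using integral_nonneg_eq_0_iff_AE[OF integrable_inner[OF f f]] f by (simp add: L2_fun_zero)
  qed
  show "norm f = sqrt (inner f f)" by (rule norm_L2_def)
  show "cinner f g = cnj (cinner g f)"
    by transfer (subst cinner_commute, simp add: integral_cnj)
  show "cinner (f + g) h = cinner f h + cinner g h"
    by transfer (simp add: cinner_add_left integrable_cinner)
  show "cinner (c *\<^sub>C f) g = c * cinner f g"
    by transfer (simp add: cinner_scaleC_left)
  show "Re (cinner f g) = inner f g"
    by transfer (simp add: integral_Re[symmetric] integrable_cinner Re_cinner)
qed

end

lemma rep_L2_in: "rep_L2 f \<in> L2_fun"
  using Quotient_rep_reflp[OF Quotient_L2] by blast

lemma abs_rep_L2: "abs_L2 (rep_L2 f) = f"
  using Quotient_abs_rep[OF Quotient_L2] .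

lemma abs_L2_eq_iff:
  "f \<in> L2_fun \<Longrightarrow> g \<in> L2_fun \<Longrightarrow> abs_L2 f = abs_L2 g \<longleftrightarrow> (AE \<zeta> in circle. f \<zeta> = g \<zeta>)"
  using Quotient_rel[OF Quotient_L2, of f g] by auto

lemma AE_rep_abs_L2: "f \<in> L2_fun \<Longrightarrow> AE \<zeta> in circle. rep_L2 (abs_L2 f) \<zeta> = f \<zeta>"
  using abs_L2_eq_iff[OF rep_L2_in, of f "abs_L2 f"] by (simp add: abs_rep_L2)

lemma abs_L2_zero: "abs_L2 (\<lambda>_. 0) = 0"
  by (simp add: zero_L2_def)

lemma abs_L2_add:
  "f \<in> L2_fun \<Longrightarrow> g \<in> L2_fun \<Longrightarrow> abs_L2 (\<lambda>\<zeta>. f \<zeta> + g \<zeta>) = abs_L2 f + abs_L2 g"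
  by (simp add: plus_L2.abs_eq)

lemma abs_L2_scaleC: "f \<in> L2_fun \<Longrightarrow> abs_L2 (\<lambda>\<zeta>. c *\<^sub>C f \<zeta>) = c *\<^sub>C abs_L2 f"
  by (simp add: scaleC_L2.abs_eq)

definition mult_op :: "(complex \<Rightarrow> 'e \<Rightarrow> 'e) \<Rightarrow> 'e L2 \<Rightarrow> 'e :: separable_chilbert L2" where
  "mult_op \<Phi> f = abs_L2 (\<lambda>\<zeta>. \<Phi> \<zeta> (rep_L2 f \<zeta>))"

text \<open>
  Representatives of the essentially bounded operator-valued functions; measurability is with
  respect to the weak operator topology.
\<close>

definition Linf_op :: "(complex \<Rightarrow> 'e \<Rightarrow> 'e :: separable_chilbert) set" where
  "Linf_op = {\<Phi>. (\<forall>\<zeta>\<in>sphere 0 1. bounded_clinear (\<Phi> \<zeta>)) \<and>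
                 (\<forall>x y. (\<lambda>\<zeta>. cinner (\<Phi> \<zeta> x) y) \<in> borel_measurable circle) \<and>
                 (\<exists>K. AE \<zeta> in circle. onorm (\<Phi> \<zeta>) \<le> K)}"


lemma Linf_op_mult:
  fixes \<Phi> :: "complex \<Rightarrow> 'e \<Rightarrow> 'e :: separable_chilbert"
  assumes \<Phi>: "\<Phi> \<in> Linf_op" and f: "f \<in> L2_fun"
  shows "(\<lambda>\<zeta>. \<Phi> \<zeta> (f \<zeta>)) \<in> L2_fun"
proof -
  have lin: "bounded_clinear (\<Phi> \<zeta>)" if "\<zeta> \<in> sphere 0 1" for \<zeta>
    using \<Phi> that by (auto simp: Linf_op_def)
  have wm: "(\<lambda>\<zeta>. cinner (\<Phi> \<zeta> x) y) \<in> borel_measurable circle" for x y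
    using \<Phi> by (auto simp: Linf_op_def)
  obtain K where K: "AE \<zeta> in circle. onorm (\<Phi> \<zeta>) \<le> K"
    using \<Phi> by (auto simp: Linf_op_def)
  have fm: "f \<in> borel_measurable circle"
    using f by (auto simp: L2_fun_def)
  obtain s where s: "\<And>i. simple_function circle (s i)"
    "\<And>\<zeta>. \<zeta> \<in> space circle \<Longrightarrow> (\<lambda>i. s i \<zeta>) \<longlonglongrightarrow> f \<zeta>"
    using borel_measurable_implies_sequence_metric[OF fm, of 0] by metis
  have weak: "(\<lambda>\<zeta>. cinner (\<Phi> \<zeta> (f \<zeta>)) y) \<in> borel_measurable circle" for y
  proof (rule borel_measurable_LIMSEQ_metric)
    fix i
    have "(\<lambda>\<zeta>. \<Sum>x\<in>s i ` space circle. indicator (s i -` {x} \<inter> space circle) \<zeta> * cinner (\<Phi> \<zeta> x) y)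
      \<in> borel_measurable circle"
      using s(1)[of i] wm
      by (intro borel_measurable_sum borel_measurable_times borel_measurable_indicator)
         (auto simp: simple_function_def)
    also have "?this \<longleftrightarrow> (\<lambda>\<zeta>. cinner (\<Phi> \<zeta> (s i \<zeta>)) y) \<in> borel_measurable circle"
    proof (rule measurable_cong)
      fix \<zeta> assume z: "\<zeta> \<in> space circle"
      have "(\<Sum>x\<in>s i ` space circle. indicator (s i -` {x} \<inter> space circle) \<zeta> * cinner (\<Phi> \<zeta> x) y)
        = (\<Sum>x\<in>s i ` space circle. if x = s i \<zeta> then cinner (\<Phi> \<zeta> x) y else 0)"
        using z by (intro sum.cong) (auto simp: indicator_def)
      also have "\<dots> = cinner (\<Phi> \<zeta> (s i \<zeta>)) y"
        using s(1)[of i] z by (simp add: simple_function_def)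
      finally show "(\<Sum>x\<in>s i ` space circle. indicator (s i -` {x} \<inter> space circle) \<zeta> * cinner (\<Phi> \<zeta> x) y)
        = cinner (\<Phi> \<zeta> (s i \<zeta>)) y" .
    qed
    finally show "(\<lambda>\<zeta>. cinner (\<Phi> \<zeta> (s i \<zeta>)) y) \<in> borel_measurable circle" .
  next
    fix \<zeta> assume z: "\<zeta> \<in> space circle"
    then have "bounded_linear (\<Phi> \<zeta>)" using lin by (auto simp: bounded_clinear_def)
    from bounded_linear.tendsto[OF this s(2)[OF z]]
    show "(\<lambda>i. cinner (\<Phi> \<zeta> (s i \<zeta>)) y) \<longlonglongrightarrow> cinner (\<Phi> \<zeta> (f \<zeta>)) y"
      by (rule bounded_bilinear.tendsto[OF bounded_bilinear_cinner _ tendsto_const])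
  qed
  have meas: "(\<lambda>\<zeta>. \<Phi> \<zeta> (f \<zeta>)) \<in> borel_measurable circle"
    using weak by (rule borel_measurable_weak)
  have "integrable circle (\<lambda>\<zeta>. K\<^sup>2 * (norm (f \<zeta>))\<^sup>2)"
    using f by (auto simp: L2_fun_def)
  then have "integrable circle (\<lambda>\<zeta>. (norm (\<Phi> \<zeta> (f \<zeta>)))\<^sup>2)"
  proof (rule Bochner_Integration.integrable_bound)
    show "AE \<zeta> in circle. norm ((norm (\<Phi> \<zeta> (f \<zeta>)))\<^sup>2) \<le> norm (K\<^sup>2 * (norm (f \<zeta>))\<^sup>2)"
      using K AE_space
    proof eventually_elim
      case (elim \<zeta>)
      then have "norm (\<Phi> \<zeta> (f \<zeta>)) \<le> onorm (\<Phi> \<zeta>) * norm (f \<zeta>)"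
        using lin by (intro onorm) (auto simp: bounded_clinear_def)
      also have "\<dots> \<le> K * norm (f \<zeta>)"
        using elim by (intro mult_right_mono) auto
      finally have "(norm (\<Phi> \<zeta> (f \<zeta>)))\<^sup>2 \<le> (K * norm (f \<zeta>))\<^sup>2"
        by (intro power_mono) auto
      then show ?case by (simp add: power_mult_distrib)
    qed
  qed (use meas in measurable)
  with meas show ?thesis by (simp add: L2_fun_def)
qed


section \<open>The Hardy space\<close>

definition hardy_disc :: "(complex \<Rightarrow> 'e :: separable_chilbert) set" where
  "hardy_disc = {f. \<exists>a. summable (\<lambda>n. (norm (a n))\<^sup>2) \<and> (\<forall>z\<in>ball 0 1. (\<lambda>n. z ^ n *\<^sub>C a n) sums f z)}"

text \<open>
  The boundary function of \<open>f\<close> is the limit in $L^2$ of its dilates $f(r\,\cdot)$ as $r$ increases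
  to $1$, which agrees almost everywhere with its radial limit.
\<close>

definition boundary_value :: "(complex \<Rightarrow> 'e :: separable_chilbert) \<Rightarrow> 'e L2 \<Rightarrow> bool" where
  "boundary_value f g \<longleftrightarrow> ((\<lambda>r. abs_L2 (\<lambda>\<zeta>. f (complex_of_real r * \<zeta>))) \<longlongrightarrow> g) (at_left 1)"

definition H2 :: "'e :: separable_chilbert L2 set" where
  "H2 = {g. \<exists>f\<in>hardy_disc. boundary_value f g}"

lemma hardy_disc_dilate:
  fixes f :: "complex \<Rightarrow> 'e :: separable_chilbert"
  assumes f: "f \<in> hardy_disc" and r: "0 \<le> r" "r < 1"
  shows "(\<lambda>\<zeta>. f (complex_of_real r * \<zeta>)) \<in> L2_fun"
proof -
  interpret prob_space circle by (rule prob_space_circle)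
  obtain a where a: "summable (\<lambda>n. (norm (a n))\<^sup>2)"
    and fa: "\<And>z. z \<in> ball 0 1 \<Longrightarrow> (\<lambda>n. z ^ n *\<^sub>C a n) sums f z"
    using f by (auto simp: hardy_disc_def)
  have "(\<lambda>n. (norm (a n))\<^sup>2) \<longlonglongrightarrow> 0" by (rule summable_LIMSEQ_zero[OF a])
  then have "Bseq (\<lambda>n. (norm (a n))\<^sup>2)" by (rule convergent_imp_Bseq[OF convergentI])
  then obtain K where K: "\<And>n. (norm (a n))\<^sup>2 \<le> K" by (auto simp: Bseq_def)
  have aK: "norm (a n) \<le> sqrt K" for n using K by (rule real_le_rsqrt)
  have sms: "summable (\<lambda>n. r ^ n * sqrt K)"
    using r by (intro summable_mult2 summable_geometric) auto
  have bd: "norm ((complex_of_real r * \<zeta>) ^ n *\<^sub>C a n) \<le> r ^ n * sqrt K"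
    if "\<zeta> \<in> sphere 0 1" for \<zeta> n
    using that r aK[of n] by (simp add: norm_power norm_mult mult_left_mono)
  have in_ball: "complex_of_real r * \<zeta> \<in> ball 0 1" if "\<zeta> \<in> sphere 0 1" for \<zeta>
    using that r by (simp add: norm_mult)
  have id: "(\<lambda>\<zeta>. \<zeta>) \<in> borel_measurable circle"
    using measurable_restrict_space1[of "\<lambda>x. x" borel borel] by (simp cong: measurable_cong_sets add: sets_circle)
  have meas: "(\<lambda>\<zeta>. f (complex_of_real r * \<zeta>)) \<in> borel_measurable circle"
  proof (rule borel_measurable_LIMSEQ_metric)
    show "(\<lambda>\<zeta>. \<Sum>n<N. (complex_of_real r * \<zeta>) ^ n *\<^sub>C a n) \<in> borel_measurable circle" for N
      using id by measurable
    show "(\<lambda>N. \<Sum>n<N. (complex_of_real r * \<zeta>) ^ n *\<^sub>C a n) \<longlonglongrightarrow> f (complex_of_real r * \<zeta>)"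
      if "\<zeta> \<in> space circle" for \<zeta>
      using fa[OF in_ball, of \<zeta>] that by (simp add: sums_def)
  qed
  have "norm (f (complex_of_real r * \<zeta>)) \<le> (\<Sum>n. r ^ n * sqrt K)" if "\<zeta> \<in> sphere 0 1" for \<zeta>
    using norm_suminf_le[OF bd[OF that] sms] sums_unique[OF fa[OF in_ball[OF that]]]
    by simp
  then have "AE \<zeta> in circle. norm ((norm (f (complex_of_real r * \<zeta>)))\<^sup>2) \<le> (\<Sum>n. r ^ n * sqrt K)\<^sup>2"
    by (intro AE_I2) (auto intro!: power_mono)
  then show ?thesis
    using meas unfolding L2_fun_def by (auto intro!: integrable_const_bound)
qed

lemma eventually_dilate: "\<forall>\<^sub>F r in at_left (1 :: real). 0 \<le> r \<and> r < 1"
  by (intro eventually_at_leftI[of 0]) auto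

lemma boundary_value_add:
  assumes "f1 \<in> hardy_disc" "f2 \<in> hardy_disc" "boundary_value f1 g1" "boundary_value f2 g2"
  shows "boundary_value (\<lambda>z. f1 z + f2 z) (g1 + g2)"
  unfolding boundary_value_def
proof (rule Lim_transform_eventually)
  show "((\<lambda>r. abs_L2 (\<lambda>\<zeta>. f1 (complex_of_real r * \<zeta>)) + abs_L2 (\<lambda>\<zeta>. f2 (complex_of_real r * \<zeta>)))
      \<longlongrightarrow> g1 + g2) (at_left 1)"
    using assms by (intro tendsto_add) (auto simp: boundary_value_def)
  show "\<forall>\<^sub>F r in at_left 1. abs_L2 (\<lambda>\<zeta>. f1 (complex_of_real r * \<zeta>)) + abs_L2 (\<lambda>\<zeta>. f2 (complex_of_real r * \<zeta>))
      = abs_L2 (\<lambda>\<zeta>. f1 (complex_of_real r * \<zeta>) + f2 (complex_of_real r * \<zeta>))"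
    using eventually_dilate by eventually_elim (simp add: abs_L2_add hardy_disc_dilate assms)
qed

lemma boundary_value_scaleC:
  assumes "f \<in> hardy_disc" "boundary_value f g"
  shows "boundary_value (\<lambda>z. c *\<^sub>C f z) (c *\<^sub>C g)"
  unfolding boundary_value_def
proof (rule Lim_transform_eventually)
  show "((\<lambda>r. c *\<^sub>C abs_L2 (\<lambda>\<zeta>. f (complex_of_real r * \<zeta>))) \<longlongrightarrow> c *\<^sub>C g) (at_left 1)"
    using assms bounded_linear.tendsto[OF bounded_linear_scaleC] by (auto simp: boundary_value_def)
  show "\<forall>\<^sub>F r in at_left 1. c *\<^sub>C abs_L2 (\<lambda>\<zeta>. f (complex_of_real r * \<zeta>))
      = abs_L2 (\<lambda>\<zeta>. c *\<^sub>C f (complex_of_real r * \<zeta>))"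
    using eventually_dilate by eventually_elim (simp add: abs_L2_scaleC hardy_disc_dilate assms)
qed

lemma hardy_disc_add:
  fixes f g :: "complex \<Rightarrow> 'e :: separable_chilbert"
  assumes "f \<in> hardy_disc" "g \<in> hardy_disc"
  shows "(\<lambda>z. f z + g z) \<in> hardy_disc"
proof -
  obtain a b where ab: "summable (\<lambda>n. (norm (a n))\<^sup>2)" "summable (\<lambda>n. (norm (b n))\<^sup>2)"
    "\<And>z. z \<in> ball 0 1 \<Longrightarrow> (\<lambda>n. z ^ n *\<^sub>C a n) sums f z"
    "\<And>z. z \<in> ball 0 1 \<Longrightarrow> (\<lambda>n. z ^ n *\<^sub>C b n) sums g z"
    using assms by (auto simp: hardy_disc_def)
  have "summable (\<lambda>n. (norm (a n + b n))\<^sup>2)"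
  proof (rule summable_comparison_test')
    show "summable (\<lambda>n. 2 * (norm (a n))\<^sup>2 + 2 * (norm (b n))\<^sup>2)"
      using ab by (intro summable_add summable_mult)
    show "norm ((norm (a n + b n))\<^sup>2) \<le> 2 * (norm (a n))\<^sup>2 + 2 * (norm (b n))\<^sup>2" for n
    proof -
      have "(norm (a n + b n))\<^sup>2 \<le> (norm (a n) + norm (b n))\<^sup>2"
        by (intro power_mono norm_triangle_ineq) auto
      then show ?thesis
        using sum_squares_bound[of "norm (a n)" "norm (b n)"] by (simp add: power2_sum)
    qed
  qed
  with ab show ?thesis
    unfolding hardy_disc_def
    by (intro CollectI exI[of _ "\<lambda>n. a n + b n"]) (auto simp: scaleC_add_right intro!: sums_add)
qed

lemma hardy_disc_scaleC:
  fixes f :: "complex \<Rightarrow> 'e :: separable_chilbert"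
  assumes "f \<in> hardy_disc"
  shows "(\<lambda>z. c *\<^sub>C f z) \<in> hardy_disc"
proof -
  obtain a where a: "summable (\<lambda>n. (norm (a n))\<^sup>2)"
    "\<And>z. z \<in> ball 0 1 \<Longrightarrow> (\<lambda>n. z ^ n *\<^sub>C a n) sums f z"
    using assms by (auto simp: hardy_disc_def)
  have "(\<lambda>n. z ^ n *\<^sub>C c *\<^sub>C a n) sums (c *\<^sub>C f z)" if "z \<in> ball 0 1" for z
    using bounded_linear.sums[OF bounded_linear_scaleC a(2)[OF that], of c]
    by (simp add: scaleC_scaleC mult.commute)
  with a show ?thesis
    unfolding hardy_disc_def
    by (intro CollectI exI[of _ "\<lambda>n. c *\<^sub>C a n"]) (auto simp: power_mult_distrib intro!: summable_mult)
qed

lemma H2_add: "g \<in> H2 \<Longrightarrow> h \<in> H2 \<Longrightarrow> g + h \<in> H2"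
  unfolding H2_def using hardy_disc_add boundary_value_add by blast

lemma H2_scaleC: "g \<in> H2 \<Longrightarrow> c *\<^sub>C g \<in> H2"
  unfolding H2_def using hardy_disc_scaleC boundary_value_scaleC by blast

lemma H2_scaleR: "g \<in> H2 \<Longrightarrow> r *\<^sub>R g \<in> H2"
  using H2_scaleC[of g "complex_of_real r"] by (simp add: scaleC_of_real)

lemma H2_zero: "0 \<in> H2"
proof -
  have "(\<lambda>_. 0 :: 'a) \<in> hardy_disc"
    unfolding hardy_disc_def by (intro CollectI exI[of _ "\<lambda>_. 0"]) auto
  moreover have "boundary_value (\<lambda>_. 0 :: 'a) 0"
    by (simp add: boundary_value_def abs_L2_zero)
  ultimately show ?thesis
    unfolding H2_def by blast
qed

lemma H2_minus: "g \<in> H2 \<Longrightarrow> - g \<in> H2"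
  using H2_scaleR[of g "- 1"] by simp

lemma H2_diff: "g \<in> H2 \<Longrightarrow> h \<in> H2 \<Longrightarrow> g - h \<in> H2"
  using H2_add[of g "- h"] H2_minus[of h] by simp

typedef (overloaded) 'e hardy = "H2 :: 'e :: separable_chilbert L2 set"
  using H2_zero by blast

setup_lifting type_definition_hardy

instantiation hardy :: (separable_chilbert) complex_inner
begin

lift_definition zero_hardy :: "'a hardy" is 0 by (rule H2_zero)
lift_definition plus_hardy :: "'a hardy \<Rightarrow> 'a hardy \<Rightarrow> 'a hardy" is "(+)" by (rule H2_add)
lift_definition minus_hardy :: "'a hardy \<Rightarrow> 'a hardy \<Rightarrow> 'a hardy" is "(-)" by (rule H2_diff)
lift_definition uminus_hardy :: "'a hardy \<Rightarrow> 'a hardy" is uminus by (rule H2_minus)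
lift_definition scaleR_hardy :: "real \<Rightarrow> 'a hardy \<Rightarrow> 'a hardy" is scaleR by (rule H2_scaleR)
lift_definition scaleC_hardy :: "complex \<Rightarrow> 'a hardy \<Rightarrow> 'a hardy" is scaleC by (rule H2_scaleC)
lift_definition inner_hardy :: "'a hardy \<Rightarrow> 'a hardy \<Rightarrow> real" is inner .
lift_definition cinner_hardy :: "'a hardy \<Rightarrow> 'a hardy \<Rightarrow> complex" is cinner .
lift_definition norm_hardy :: "'a hardy \<Rightarrow> real" is norm .
lift_definition dist_hardy :: "'a hardy \<Rightarrow> 'a hardy \<Rightarrow> real" is dist .
lift_definition sgn_hardy :: "'a hardy \<Rightarrow> 'a hardy" is sgn by (simp add: sgn_div_norm H2_scaleR)
definition uniformity_hardy :: "('a hardy \<times> 'a hardy) filter" where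
  "uniformity_hardy = (INF e\<in>{0<..}. principal {(f, g). dist f g < e})"
definition open_hardy :: "'a hardy set \<Rightarrow> bool" where
  "open_hardy U \<longleftrightarrow> (\<forall>x\<in>U. eventually (\<lambda>(x', y). x' = x \<longrightarrow> y \<in> U) uniformity)"

instance
proof
  fix f g h :: "'a hardy" and r s :: real and c d :: complex
  show "f + g + h = f + (g + h)" by transfer simp
  show "f + g = g + f" by transfer simp
  show "0 + f = f" by transfer simp
  show "- f + f = 0" by transfer simp
  show "f - g = f + - g" by transfer simp
  show "r *\<^sub>R (f + g) = r *\<^sub>R f + r *\<^sub>R g" by transfer (rule scaleR_add_right)
  show "(r + s) *\<^sub>R f = r *\<^sub>R f + s *\<^sub>R f" by transfer (rule scaleR_add_left)
  show "r *\<^sub>R s *\<^sub>R f = (r * s) *\<^sub>R f" by transfer simp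
  show "1 *\<^sub>R f = f" by transfer simp
  show "c *\<^sub>C (f + g) = c *\<^sub>C f + c *\<^sub>C g" by transfer (rule scaleC_add_right)
  show "(c + d) *\<^sub>C f = c *\<^sub>C f + d *\<^sub>C f" by transfer (rule scaleC_add_left)
  show "c *\<^sub>C d *\<^sub>C f = (c * d) *\<^sub>C f" by transfer (rule scaleC_scaleC)
  show "complex_of_real r *\<^sub>C f = r *\<^sub>R f" by transfer (rule scaleC_of_real)
  show "dist f g = norm (f - g)" by transfer (rule dist_norm)
  show "sgn f = inverse (norm f) *\<^sub>R f" by transfer (rule sgn_div_norm)
  show "uniformity = (INF e\<in>{0<..}. principal {(f, g :: 'a hardy). dist f g < e})"
    by (rule uniformity_hardy_def)
  show "open U = (\<forall>x\<in>U. \<forall>\<^sub>F (x', y) in uniformity. x' = x \<longrightarrow> y \<in> U)" for U :: "'a hardy set"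
    by (rule open_hardy_def)
  show "inner f g = inner g f" by transfer (rule inner_commute)
  show "inner (f + g) h = inner f h + inner g h" by transfer (rule inner_add_left)
  show "inner (r *\<^sub>R f) g = r * inner f g" by transfer simp
  show "0 \<le> inner f f" by transfer simp
  show "inner f f = 0 \<longleftrightarrow> f = 0" by transfer simp
  show "norm f = sqrt (inner f f)" by transfer (rule norm_eq_sqrt_inner)
  show "cinner f g = cnj (cinner g f)" by transfer (rule cinner_commute)
  show "cinner (f + g) h = cinner f h + cinner g h" by transfer (rule cinner_add_left)
  show "cinner (c *\<^sub>C f) g = c * cinner f g" by transfer (rule cinner_scaleC_left)
  show "Re (cinner f g) = inner f g" by transfer (rule Re_cinner)
qed

end

lemma norm_abs_L2: "f \<in> L2_fun \<Longrightarrow> (norm (abs_L2 f))\<^sup>2 = (\<integral>\<zeta>. (norm (f \<zeta>))\<^sup>2 \<partial>circle)"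
  by (simp add: power2_norm_eq_inner inner_L2.abs_eq)

lemma mult_op_abs:
  assumes "\<Phi> \<in> Linf_op" "f \<in> L2_fun"
  shows "mult_op \<Phi> (abs_L2 f) = abs_L2 (\<lambda>\<zeta>. \<Phi> \<zeta> (f \<zeta>))"
proof -
  have "AE \<zeta> in circle. \<Phi> \<zeta> (rep_L2 (abs_L2 f) \<zeta>) = \<Phi> \<zeta> (f \<zeta>)"
    using AE_rep_abs_L2[OF assms(2)] by eventually_elim simp
  then show ?thesis
    unfolding mult_op_def
    by (subst abs_L2_eq_iff) (auto intro: Linf_op_mult assms rep_L2_in)
qed

lemma Linf_op_coord: "(\<lambda>\<zeta> x. \<zeta> *\<^sub>C x) \<in> Linf_op"
proof -
  have id: "(\<lambda>\<zeta>. \<zeta>) \<in> borel_measurable circle"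
    using measurable_restrict_space1[of "\<lambda>x. x" borel borel]
    by (simp cong: measurable_cong_sets add: sets_circle)
  have "onorm (\<lambda>x :: 'a. \<zeta> *\<^sub>C x) \<le> 1" if "\<zeta> \<in> sphere 0 1" for \<zeta>
    using that by (intro onorm_bound) auto
  then show ?thesis
    unfolding Linf_op_def bounded_clinear_def using id
    by (auto simp: bounded_linear_scaleC scaleC_scaleC mult.commute cinner_scaleC_left
         intro!: exI[of _ 1] AE_I2)
qed

lemma boundary_value_shift:
  assumes f: "f \<in> hardy_disc" and g: "boundary_value f g"
  shows "boundary_value (\<lambda>z. z *\<^sub>C f z) (mult_op (\<lambda>\<zeta> x. \<zeta> *\<^sub>C x) g)"
proof -
  let ?M = "mult_op (\<lambda>\<zeta> x :: 'a. \<zeta> *\<^sub>C x)"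
  have M: "?M (abs_L2 u) = abs_L2 (\<lambda>\<zeta>. \<zeta> *\<^sub>C u \<zeta>)" "(\<lambda>\<zeta>. \<zeta> *\<^sub>C u \<zeta>) \<in> L2_fun" if "u \<in> L2_fun" for u :: "complex \<Rightarrow> 'a"
    using mult_op_abs[OF Linf_op_coord that] Linf_op_mult[OF Linf_op_coord that] by auto
  have iso: "norm (?M u - ?M v) = norm (u - v)" for u v :: "'a L2"
  proof -
    define p where "p = (\<lambda>\<zeta>. rep_L2 u \<zeta> - rep_L2 v \<zeta>)"
    have p: "p \<in> L2_fun" unfolding p_def by (intro L2_fun_diff rep_L2_in)
    have "u - v = abs_L2 p"
      unfolding p_def using rep_L2_in by (subst minus_L2.abs_eq[symmetric]) (auto simp: abs_rep_L2)
    moreover have "?M u - ?M v = abs_L2 (\<lambda>\<zeta>. \<zeta> *\<^sub>C p \<zeta>)"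
      unfolding mult_op_def p_def using M(2)[OF rep_L2_in]
      by (subst minus_L2.abs_eq) (auto simp: scaleC_diff_right)
    moreover have "(norm (abs_L2 (\<lambda>\<zeta>. \<zeta> *\<^sub>C p \<zeta>)))\<^sup>2 = (norm (abs_L2 p))\<^sup>2"
      using p M(2)[OF p] by (auto simp: norm_abs_L2 intro!: Bochner_Integration.integral_cong)
    ultimately show ?thesis by simp
  qed
  have lim: "((\<lambda>r. abs_L2 (\<lambda>\<zeta>. f (complex_of_real r * \<zeta>))) \<longlongrightarrow> g) (at_left 1)"
    using g by (simp add: boundary_value_def)
  have "((\<lambda>r. ?M (abs_L2 (\<lambda>\<zeta>. f (complex_of_real r * \<zeta>)))) \<longlongrightarrow> ?M g) (at_left 1)"
    using lim unfolding tendsto_iff dist_norm iso .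
  then have "((\<lambda>r. complex_of_real r *\<^sub>C ?M (abs_L2 (\<lambda>\<zeta>. f (complex_of_real r * \<zeta>)))) \<longlongrightarrow> complex_of_real 1 *\<^sub>C ?M g) (at_left 1)"
    by (intro bounded_bilinear.tendsto[OF bounded_bilinear_scaleC] tendsto_intros)
  moreover have "\<forall>\<^sub>F r in at_left 1. complex_of_real r *\<^sub>C ?M (abs_L2 (\<lambda>\<zeta>. f (complex_of_real r * \<zeta>)))
      = abs_L2 (\<lambda>\<zeta>. (complex_of_real r * \<zeta>) *\<^sub>C f (complex_of_real r * \<zeta>))"
    using eventually_dilate
  proof eventually_elim
    case (elim r)
    then have d: "(\<lambda>\<zeta>. f (complex_of_real r * \<zeta>)) \<in> L2_fun" using f hardy_disc_dilate by blast
    show ?case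
      unfolding M(1)[OF d] abs_L2_scaleC[OF M(2)[OF d], symmetric] by (simp add: scaleC_scaleC)
  qed
  ultimately show ?thesis
    unfolding boundary_value_def using Lim_transform_eventually by fastforce
qed

lemma hardy_disc_shift:
  fixes f :: "complex \<Rightarrow> 'e :: separable_chilbert"
  assumes "f \<in> hardy_disc"
  shows "(\<lambda>z. z *\<^sub>C f z) \<in> hardy_disc"
proof -
  obtain a where a: "summable (\<lambda>n. (norm (a n))\<^sup>2)"
    "\<And>z. z \<in> ball 0 1 \<Longrightarrow> (\<lambda>n. z ^ n *\<^sub>C a n) sums f z"
    using assms by (auto simp: hardy_disc_def)
  let ?b = "\<lambda>n. case n of 0 \<Rightarrow> 0 | Suc m \<Rightarrow> a m"
  have "summable (\<lambda>n. (norm (?b n))\<^sup>2)"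
    using a(1) by (subst summable_Suc_iff[symmetric]) simp
  moreover have "(\<lambda>n. z ^ n *\<^sub>C ?b n) sums (z *\<^sub>C f z)" if "z \<in> ball 0 1" for z
  proof -
    have "(\<lambda>n. z ^ Suc n *\<^sub>C ?b (Suc n)) sums (z *\<^sub>C f z)"
      using bounded_linear.sums[OF bounded_linear_scaleC a(2)[OF that], of z]
      by (simp add: scaleC_scaleC)
    then show ?thesis
      by (subst (asm) sums_Suc_iff) simp
  qed
  ultimately show ?thesis
    unfolding hardy_disc_def by blast
qed

lemma H2_shift: "g \<in> H2 \<Longrightarrow> mult_op (\<lambda>\<zeta> x. \<zeta> *\<^sub>C x) g \<in> H2"
  unfolding H2_def using hardy_disc_shift boundary_value_shift by blast

text \<open>
  On boundary values, multiplication by $z$ is multiplication by the coordinate function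
  (see \<open>boundary_value_shift\<close>).
\<close>

lift_definition shift :: "'e :: separable_chilbert hardy \<Rightarrow> 'e hardy"
  is "mult_op (\<lambda>\<zeta> x. \<zeta> *\<^sub>C x)"
  by (rule H2_shift)

definition toeplitz :: "(complex \<Rightarrow> 'e \<Rightarrow> 'e) \<Rightarrow> 'e :: separable_chilbert hardy \<Rightarrow> 'e hardy" where
  "toeplitz \<Phi> f = Abs_hardy (orth_proj H2 (mult_op \<Phi> (Rep_hardy f)))"

end

theory Submission
  imports Defs
begin

text \<open>
  Write \<open>A\<close> for the backward shift, \<open>S\<close> for the shift and \<open>X\<close> for the Toeplitz operator. Since
  \<open>A S = I\<close> and \<open>A X S = X\<close>, every summand of the corner entry \<open>\<Sum>k<n. A\<^sup>k X A\<^sup>n\<^sup>-\<^sup>1\<^sup>-\<^sup>k\<close> of the \<open>n\<close>-th power of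
  the block operator maps \<open>S\<^sup>n h\<close> to \<open>X S h\<close>, so that power sends \<open>(0, S\<^sup>n h)\<close> to \<open>(n X S h, h)\<close>.
  An operator similar to a contraction is power bounded and \<open>S\<close> is isometric, whence \<open>X S = 0\<close>
  and \<open>X = A X S = 0\<close>. The matrix coefficients of \<open>X\<close> on monomials are all the Fourier
  coefficients of the scalar functions \<open>\<zeta> \<mapsto> \<langle>\<Phi>(\<zeta>) x, y\<rangle>\<close>, so the symbol vanishes.
\<close>

section \<open>Complex inner products\<close>

lemma cinner_diff_left: "cinner (x - y) z = cinner x z - cinner y (z :: 'a :: complex_inner)"
  using bounded_bilinear_cinner by (rule bounded_bilinear.diff_left)

lemma cinner_zero_left [simp]: "cinner 0 (z :: 'a :: complex_inner) = 0"
  using bounded_bilinear_cinner by (rule bounded_bilinear.zero_left)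

lemma cinner_sum_left: "cinner (sum f A) y = (\<Sum>i\<in>A. cinner (f i) (y :: 'a :: complex_inner))"
  using bounded_bilinear_cinner by (rule bounded_bilinear.sum_left)

lemma cinner_sum_right: "cinner y (sum f A) = (\<Sum>i\<in>A. cinner (y :: 'a :: complex_inner) (f i))"
  using bounded_bilinear_cinner by (rule bounded_bilinear.sum_right)

lemma tendsto_cinner [tendsto_intros]:
  fixes f g :: "'b \<Rightarrow> 'a :: complex_inner"
  shows "(f \<longlongrightarrow> a) F \<Longrightarrow> (g \<longlongrightarrow> b) F \<Longrightarrow> ((\<lambda>x. cinner (f x) (g x)) \<longlongrightarrow> cinner a b) F"
  by (rule bounded_bilinear.tendsto[OF bounded_bilinear_cinner])

lemma bounded_linear_cinner_left: "bounded_linear (\<lambda>x. cinner x (y :: 'a :: complex_inner))"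
  using bounded_bilinear_cinner by (rule bounded_bilinear.bounded_linear_left)

lemma cinner_self_eq_0_iff: "cinner x x = 0 \<longleftrightarrow> (x :: 'a :: complex_inner) = 0"
  by (simp add: cinner_self)

lemma cinner_left_eqI:
  fixes u v :: "'a :: complex_inner"
  assumes "\<And>y. cinner u y = cinner v y"
  shows "u = v"
  using assms[of "u - v"] cinner_self_eq_0_iff[of "u - v"] by (simp add: cinner_diff_left)

lemma cinner_right_eqI:
  fixes u v :: "'a :: complex_inner"
  assumes "\<And>x. cinner x u = cinner x v"
  shows "u = v"
  using assms by (metis cinner_commute cinner_left_eqI)

text \<open>Density in sequential form: the symbol is first shown to vanish against countably many
  vectors, and continuity along such sequences then reaches all the others.\<close>

lemma dense_separable_chilbert:
  obtains D :: "'e :: separable_chilbert set"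
  where "countable D" "\<And>x. \<exists>X. (\<forall>n. X n \<in> D) \<and> X \<longlonglongrightarrow> x"
proof -
  obtain D :: "'e set" where D: "countable D" "\<And>x e. e > 0 \<Longrightarrow> \<exists>d\<in>D. dist d x < e"
    using separable by blast
  have "\<exists>X. (\<forall>n. X n \<in> D) \<and> X \<longlonglongrightarrow> x" for x
  proof -
    have "\<forall>n. \<exists>d\<in>D. dist d x < inverse (real (Suc n))"
      using D(2) by simp
    then obtain X where X: "\<And>n. X n \<in> D" "\<And>n. dist (X n) x < inverse (real (Suc n))"
      by metis
    have "X \<longlonglongrightarrow> x"
    proof (rule metric_LIMSEQ_I)
      fix e :: real assume "0 < e"
      then obtain N where N: "inverse (real (Suc N)) < e" using reals_Archimedean by blast
      have "dist (X n) x < e" if "n \<ge> N" for n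
      proof -
        have "inverse (real (Suc n)) \<le> inverse (real (Suc N))"
          using that by (intro le_imp_inverse_le) auto
        with X(2)[of n] N show ?thesis by linarith
      qed
      then show "\<exists>N. \<forall>n\<ge>N. dist (X n) x < e" by blast
    qed
    with X(1) show ?thesis by blast
  qed
  with D(1) that show ?thesis by blast
qed


section \<open>Integration on the circle\<close>

lemma measurable_coord [measurable]: "(\<lambda>\<zeta>. \<zeta>) \<in> borel_measurable circle"
  using measurable_restrict_space1[of "\<lambda>x. x" borel borel]
  by (simp cong: measurable_cong_sets add: sets_circle)

lemma L2_funD: "f \<in> L2_fun \<Longrightarrow> f \<in> borel_measurable circle"
  by (simp add: L2_fun_def)

lemma cinner_abs_L2:
  "f \<in> L2_fun \<Longrightarrow> g \<in> L2_fun \<Longrightarrow> cinner (abs_L2 f) (abs_L2 g) = (\<integral>\<zeta>. cinner (f \<zeta>) (g \<zeta>) \<partial>circle)"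
  by (simp add: cinner_L2.abs_eq)

lemma abs_L2_diff:
  "f \<in> L2_fun \<Longrightarrow> g \<in> L2_fun \<Longrightarrow> abs_L2 (\<lambda>\<zeta>. f \<zeta> - g \<zeta>) = abs_L2 f - abs_L2 g"
  by (simp add: minus_L2.abs_eq)

lemma L2_fun_bounded:
  fixes f :: "complex \<Rightarrow> 'e :: separable_chilbert"
  assumes "f \<in> borel_measurable circle" "\<And>\<zeta>. norm \<zeta> = 1 \<Longrightarrow> norm (f \<zeta>) \<le> c"
  shows "f \<in> L2_fun"
proof -
  interpret prob_space circle by (rule prob_space_circle)
  have "AE \<zeta> in circle. norm ((norm (f \<zeta>))\<^sup>2) \<le> c\<^sup>2"
    using assms(2) by (intro AE_I2) (auto intro!: power_mono)
  then show ?thesis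
    using assms(1) unfolding L2_fun_def by (auto intro!: integrable_const_bound)
qed

text \<open>The total mass is one, so a bound on the circle is a bound in \<open>L2\<close>; uniform
  convergence of power series thereby becomes \<open>L2\<close> convergence.\<close>

lemma norm_abs_L2_le:
  assumes f: "f \<in> L2_fun" and c: "\<And>\<zeta>. norm \<zeta> = 1 \<Longrightarrow> norm (f \<zeta>) \<le> c" "0 \<le> c"
  shows "norm (abs_L2 f) \<le> c"
proof -
  interpret prob_space circle by (rule prob_space_circle)
  have "(norm (abs_L2 f))\<^sup>2 \<le> (\<integral>\<zeta>. c\<^sup>2 \<partial>circle)"
    unfolding norm_abs_L2[OF f] using f c(1)
    by (intro integral_mono_AE AE_I2) (auto simp: L2_fun_def intro!: power_mono)
  then have "(norm (abs_L2 f))\<^sup>2 \<le> c\<^sup>2" using prob_space by simp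
  then show ?thesis using c(2) by (rule power2_le_imp_le)
qed

lemma L2_fun_integrable: "f \<in> L2_fun \<Longrightarrow> integrable circle f"
proof -
  assume f: "f \<in> L2_fun"
  interpret prob_space circle by (rule prob_space_circle)
  have "integrable circle (\<lambda>\<zeta>. 1 + (norm (f \<zeta>))\<^sup>2)"
    using f by (auto simp: L2_fun_def)
  then show ?thesis
  proof (rule Bochner_Integration.integrable_bound)
    show "AE \<zeta> in circle. norm (f \<zeta>) \<le> norm (1 + (norm (f \<zeta>))\<^sup>2)"
    proof (rule AE_I2)
      fix \<zeta>
      show "norm (f \<zeta>) \<le> norm (1 + (norm (f \<zeta>))\<^sup>2)"
        using sum_squares_bound[of 1 "norm (f \<zeta>)"] norm_ge_zero[of "f \<zeta>"]
        by (simp del: norm_ge_zero)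
    qed
  qed (use f in \<open>simp add: L2_fun_def\<close>)
qed

lemma integral_circle:
  fixes f :: "complex \<Rightarrow> complex"
  assumes [measurable]: "f \<in> borel_measurable borel"
  shows "(\<integral>\<zeta>. f \<zeta> \<partial>circle) = (\<integral>t\<in>{0..2 * pi}. f (cis t) \<partial>lborel) / (2 * pi)"
proof -
  have [measurable]: "cis \<in> borel_measurable borel"
    by (intro borel_measurable_continuous_onI continuous_intros)
  have m: "cis \<in> uniform_measure lborel {0..2 * pi} \<rightarrow>\<^sub>M restrict_space borel (sphere 0 1)"
    by (intro measurable_restrict_space2) auto
  have u: "uniform_measure lborel {0..2 * pi} = density lborel (\<lambda>t. ennreal (indicator {0..2 * pi} t / (2 * pi)))"
    unfolding uniform_measure_def
    by (intro density_cong AE_I2) (auto simp: indicator_def divide_ennreal[symmetric] ennreal_mult' simp flip: ennreal_1 ennreal_numeral)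
  have "(\<integral>\<zeta>. f \<zeta> \<partial>circle) = (\<integral>t. f (cis t) \<partial>uniform_measure lborel {0..2 * pi})"
    unfolding circle_def using m by (rule integral_distr) (simp add: measurable_restrict_space1)
  also have "\<dots> = (\<integral>t. (indicator {0..2 * pi} t / (2 * pi)) *\<^sub>R f (cis t) \<partial>lborel)"
    unfolding u by (rule integral_density) auto
  also have "\<dots> = (\<integral>t. (indicator {0..2 * pi} t *\<^sub>R f (cis t)) / (2 * pi) \<partial>lborel)"
    by (intro Bochner_Integration.integral_cong) (auto simp: scaleR_conv_of_real)
  finally show ?thesis by (simp add: set_lebesgue_integral_def)
qed

text \<open>In the angle the integrand is \<open>cis (k * t)\<close> with \<open>k\<close> the
  integer \<open>m - n\<close>; for nonzero \<open>k\<close> it has a primitive of period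
  \<open>2 * pi\<close>.\<close>

lemma integral_circle_moment:
  "(\<integral>\<zeta>. \<zeta> ^ m * cnj \<zeta> ^ n \<partial>circle) = (if m = n then 1 else 0)"
proof -
  define k where "k = real m - real n"
  have cis: "cis t ^ m * cnj (cis t) ^ n = cis (k * t)" for t
    by (simp add: Complex.DeMoivre cis_cnj cis_mult k_def algebra_simps)
  have "(\<integral>\<zeta>. \<zeta> ^ m * cnj \<zeta> ^ n \<partial>circle) = (\<integral>t\<in>{0..2 * pi}. cis (k * t) \<partial>lborel) / (2 * pi)"
    by (subst integral_circle)
       (auto simp: cis intro!: borel_measurable_continuous_onI continuous_intros)
  also have "(\<integral>t\<in>{0..2 * pi}. cis (k * t) \<partial>lborel) = integral {0..2 * pi} (\<lambda>t. cis (k * t))"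
    by (intro set_borel_integral_eq_integral, unfold set_integrable_def, intro borel_integrable_compact)
       (auto intro!: continuous_intros)
  also have "integral {0..2 * pi} (\<lambda>t. cis (k * t)) = (if m = n then 2 * pi else 0)"
  proof (cases "m = n")
    case False
    then have k: "k \<noteq> 0" by (simp add: k_def)
    have "((\<lambda>t. cis (k * t)) has_integral
        (cis (k * (2 * pi)) / (k * \<i>) - cis (k * 0) / (k * \<i>))) {0..2 * pi}"
    proof (rule fundamental_theorem_of_calculus)
      show "((\<lambda>t. cis (k * t) / (k * \<i>)) has_vector_derivative cis (k * t)) (at t within {0..2 * pi})" for t
        using k unfolding has_vector_derivative_def
        by (auto intro!: derivative_eq_intros ext simp: scaleR_conv_of_real field_simps)
    qed simp
    moreover have "cis (k * (2 * pi)) = 1"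
      using cis_multiple_2pi[of k] by (simp add: k_def mult_ac)
    ultimately show ?thesis using False by (simp add: integral_unique)
  qed (simp add: k_def scaleR_conv_of_real)
  finally show ?thesis by simp
qed


section \<open>Completeness of the space of square integrable functions\<close>

text \<open>This is nonnegativity of the variance of the norm under a probability measure. It lets
  \<open>L2\<close> estimates control a sum of \<open>L1\<close> norms in the completeness
  proof.\<close>

lemma integral_norm_le_norm_L2:
  assumes f: "f \<in> L2_fun"
  shows "(\<integral>\<zeta>. norm (f \<zeta>) \<partial>circle) \<le> norm (abs_L2 f)"
proof -
  interpret prob_space circle by (rule prob_space_circle)
  have "0 \<le> variance (\<lambda>\<zeta>. norm (f \<zeta>))" by (rule variance_positive)
  also have "\<dots> = (\<integral>\<zeta>. (norm (f \<zeta>))\<^sup>2 \<partial>circle) - (\<integral>\<zeta>. norm (f \<zeta>) \<partial>circle)\<^sup>2"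
    using f L2_fun_integrable[OF f] by (intro variance_eq) (auto simp: L2_fun_def)
  finally have "(\<integral>\<zeta>. norm (f \<zeta>) \<partial>circle)\<^sup>2 \<le> (norm (abs_L2 f))\<^sup>2"
    by (simp add: norm_abs_L2[OF f])
  then show ?thesis by (rule power2_le_imp_le) simp
qed

lemma nn_integral_norm_sq_L2:
  "f \<in> L2_fun \<Longrightarrow> (\<integral>\<^sup>+\<zeta>. ennreal ((norm (f \<zeta>))\<^sup>2) \<partial>circle) = ennreal ((norm (abs_L2 f))\<^sup>2)"
  unfolding norm_abs_L2 by (rule nn_integral_eq_integral) (auto simp: L2_fun_def)

text \<open>The Riesz-Fischer argument: a rapidly Cauchy subsequence converges almost everywhere,
  Fatou identifies its pointwise limit as the \<open>L2\<close> limit, and a Cauchy sequence follows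
  its convergent subsequence.\<close>

lemma L2_Cauchy_convergent:
  fixes X :: "nat \<Rightarrow> 'e :: separable_chilbert L2"
  assumes X: "Cauchy X"
  shows "convergent X"
proof -
  have "\<forall>k. \<exists>N. \<forall>m\<ge>N. \<forall>n\<ge>N. dist (X m) (X n) < (1/2) ^ k"
    using X by (auto simp: Cauchy_def)
  then obtain N where N: "\<And>k m n. m \<ge> N k \<Longrightarrow> n \<ge> N k \<Longrightarrow> dist (X m) (X n) < (1/2) ^ k"
    by metis
  \<comment> \<open>The summand \<open>k\<close> makes the indices strictly increasing, and the sum
    dominates every \<open>N i\<close> with \<open>i \<le> k\<close>.\<close>
  define r where "r k = k + (\<Sum>i\<le>k. N i)" for k
  have r: "strict_mono r"
    unfolding r_def by (rule strict_monoI_Suc) simp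
  have rN: "r j \<ge> N k" if "j \<ge> k" for j k
  proof -
    have "N k \<le> (\<Sum>i\<le>j. N i)" using that by (intro member_le_sum) auto
    then show ?thesis by (simp add: r_def)
  qed
  define f where "f k = rep_L2 (X (r k))" for k
  have f: "f k \<in> L2_fun" for k by (simp add: f_def rep_L2_in)
  have [measurable]: "f k \<in> borel_measurable circle" for k using f by (rule L2_funD)
  have fX: "abs_L2 (f k) = X (r k)" for k by (simp add: f_def abs_rep_L2)
  have fd: "norm (abs_L2 (\<lambda>\<zeta>. f j \<zeta> - f k \<zeta>)) \<le> (1/2) ^ k" if "j \<ge> k" for j k
    using N[OF rN[OF that] rN[OF order_refl]]
    by (simp add: abs_L2_diff f fX dist_norm)
  let ?d = "\<lambda>k \<zeta>. f (Suc k) \<zeta> - f k \<zeta>"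
  have d: "?d k \<in> L2_fun" for k by (intro L2_fun_diff f)
  \<comment> \<open>The \<open>L1\<close> norms of consecutive differences are summable, so at
    almost every point the differences are absolutely summable and the telescoping sequence
    \<open>f k\<close> converges.\<close>
  have "(\<integral>\<^sup>+\<zeta>. (\<Sum>k. ennreal (norm (?d k \<zeta>))) \<partial>circle) = (\<Sum>k. \<integral>\<^sup>+\<zeta>. ennreal (norm (?d k \<zeta>)) \<partial>circle)"
    by (rule nn_integral_suminf) measurable
  also have "\<dots> \<le> (\<Sum>k. ennreal ((1/2) ^ k))"
  proof (intro suminf_le summableI)
    fix k
    have "(\<integral>\<^sup>+\<zeta>. ennreal (norm (?d k \<zeta>)) \<partial>circle) = ennreal (\<integral>\<zeta>. norm (?d k \<zeta>) \<partial>circle)"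
      by (intro nn_integral_eq_integral integrable_norm L2_fun_integrable d) auto
    also have "\<dots> \<le> ennreal ((1/2) ^ k)"
      using integral_norm_le_norm_L2[OF d, of k] fd[of k "Suc k"] by (intro ennreal_leI) simp
    finally show "(\<integral>\<^sup>+\<zeta>. ennreal (norm (?d k \<zeta>)) \<partial>circle) \<le> ennreal ((1/2) ^ k)" .
  qed
  also have "\<dots> = ennreal (\<Sum>k. (1/2) ^ k)"
    by (intro suminf_ennreal2 summable_geometric) auto
  finally have "(\<integral>\<^sup>+\<zeta>. (\<Sum>k. ennreal (norm (?d k \<zeta>))) \<partial>circle) \<noteq> \<infinity>"
    by (auto simp: top_unique)
  then have "AE \<zeta> in circle. (\<Sum>k. ennreal (norm (?d k \<zeta>))) \<noteq> \<infinity>"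
    by (intro nn_integral_PInf_AE) measurable
  then have lim: "AE \<zeta> in circle. (\<lambda>k. f k \<zeta>) \<longlonglongrightarrow> lim (\<lambda>k. f k \<zeta>)"
  proof eventually_elim
    case (elim \<zeta>)
    then have "summable (\<lambda>k. norm (?d k \<zeta>))"
      by (intro summable_suminf_not_top) auto
    then have "summable (\<lambda>k. ?d k \<zeta>)" by (rule summable_norm_cancel)
    then have "convergent (\<lambda>k. f 0 \<zeta> + (\<Sum>i<k. ?d i \<zeta>))"
      unfolding summable_iff_convergent by (intro convergent_add convergent_const)
    then have "convergent (\<lambda>k. f k \<zeta>)"
      by (simp add: sum_lessThan_telescope[of "\<lambda>k. f k \<zeta>"])
    then show ?case by (simp add: convergent_LIMSEQ_iff)
  qed
  define g where "g \<zeta> = lim (\<lambda>k. f k \<zeta>)" for \<zeta>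
  have [measurable]: "g \<in> borel_measurable circle"
    unfolding g_def by (rule borel_measurable_lim_metric) measurable
  \<comment> \<open>Fatou in \<open>j\<close> with \<open>k\<close> fixed: the differences
    \<open>f j - f k\<close> tend to \<open>g - f k\<close> almost everywhere and are uniformly
    small once \<open>j \<ge> k\<close>.\<close>
  have fatou: "(\<integral>\<^sup>+\<zeta>. ennreal ((norm (g \<zeta> - f k \<zeta>))\<^sup>2) \<partial>circle) \<le> ennreal (((1/2) ^ k)\<^sup>2)" for k
  proof -
    have "AE \<zeta> in circle. ennreal ((norm (g \<zeta> - f k \<zeta>))\<^sup>2)
        = liminf (\<lambda>j. ennreal ((norm (f j \<zeta> - f k \<zeta>))\<^sup>2))"
      using lim
    proof eventually_elim
      case (elim \<zeta>)
      have "(\<lambda>j. ennreal ((norm (f j \<zeta> - f k \<zeta>))\<^sup>2)) \<longlonglongrightarrow> ennreal ((norm (g \<zeta> - f k \<zeta>))\<^sup>2)"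
        unfolding g_def by (intro tendsto_ennrealI tendsto_intros elim)
      from lim_imp_Liminf[OF sequentially_bot this] show ?case by (rule sym)
    qed
    then have "(\<integral>\<^sup>+\<zeta>. ennreal ((norm (g \<zeta> - f k \<zeta>))\<^sup>2) \<partial>circle)
        = (\<integral>\<^sup>+\<zeta>. liminf (\<lambda>j. ennreal ((norm (f j \<zeta> - f k \<zeta>))\<^sup>2)) \<partial>circle)"
      by (rule nn_integral_cong_AE)
    also have "\<dots> \<le> liminf (\<lambda>j. \<integral>\<^sup>+\<zeta>. ennreal ((norm (f j \<zeta> - f k \<zeta>))\<^sup>2) \<partial>circle)"
      by (rule nn_integral_liminf) measurable
    also have "\<dots> \<le> liminf (\<lambda>j. ennreal (((1/2) ^ k)\<^sup>2))"
    proof (rule Liminf_mono)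
      show "\<forall>\<^sub>F j in sequentially. (\<integral>\<^sup>+\<zeta>. ennreal ((norm (f j \<zeta> - f k \<zeta>))\<^sup>2) \<partial>circle)
          \<le> ennreal (((1/2) ^ k)\<^sup>2)"
        using eventually_ge_at_top[of k]
      proof eventually_elim
        case (elim j)
        show ?case
          unfolding nn_integral_norm_sq_L2[OF L2_fun_diff[OF f f]]
          by (intro ennreal_leI power_mono fd elim norm_ge_zero)
      qed
    qed
    also have "\<dots> = ennreal (((1/2) ^ k)\<^sup>2)" by (simp add: Liminf_const)
    finally show ?thesis .
  qed
  have gf: "(\<lambda>\<zeta>. g \<zeta> - f k \<zeta>) \<in> L2_fun" for k
  proof -
    have "integrable circle (\<lambda>\<zeta>. (norm (g \<zeta> - f k \<zeta>))\<^sup>2)"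
      by (rule integrableI_bounded) (use fatou[of k] in \<open>auto simp: less_top[symmetric] top_unique\<close>)
    then show ?thesis by (simp add: L2_fun_def)
  qed
  have "(\<lambda>\<zeta>. (g \<zeta> - f 0 \<zeta>) + f 0 \<zeta>) \<in> L2_fun" by (intro L2_fun_add gf f)
  then have g: "g \<in> L2_fun" by simp
  have "norm (X (r k) - abs_L2 g) \<le> (1/2) ^ k" for k
  proof -
    have "(norm (abs_L2 (\<lambda>\<zeta>. g \<zeta> - f k \<zeta>)))\<^sup>2 \<le> ((1/2) ^ k)\<^sup>2"
      using fatou[of k] by (simp add: nn_integral_norm_sq_L2[OF gf] del: power_one_over)
    then have "norm (abs_L2 (\<lambda>\<zeta>. g \<zeta> - f k \<zeta>)) \<le> (1/2) ^ k"
      by (rule power2_le_imp_le) simp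
    then show ?thesis
      by (simp add: abs_L2_diff g f fX norm_minus_commute)
  qed
  moreover have "(\<lambda>k. (1/2 :: real) ^ k) \<longlonglongrightarrow> 0" by (rule LIMSEQ_power_zero) simp
  ultimately have "(\<lambda>k. X (r k) - abs_L2 g) \<longlonglongrightarrow> 0"
    by (blast intro: Lim_null_comparison always_eventually)
  then have "(X \<circ> r) \<longlonglongrightarrow> abs_L2 g"
    unfolding o_def by (rule LIM_zero_cancel)
  from Cauchy_converges_subseq[OF X r this] show ?thesis by (rule convergentI)
qed

instance L2 :: (separable_chilbert) chilbert_space
  by standard (rule L2_Cauchy_convergent)


section \<open>The orthogonal projection onto the Hardy space\<close>

lemma L2_fun_monomial: "(\<lambda>\<zeta>. \<zeta> ^ n *\<^sub>C b) \<in> L2_fun"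
  by (rule L2_fun_bounded[where c = "norm b"]) (auto simp: norm_power)

definition monomial :: "nat \<Rightarrow> 'e \<Rightarrow> 'e :: separable_chilbert L2" where
  "monomial n b = abs_L2 (\<lambda>\<zeta>. \<zeta> ^ n *\<^sub>C b)"

lemma monomial_scaleC: "monomial n (c *\<^sub>C b) = c *\<^sub>C monomial n b"
  unfolding monomial_def abs_L2_scaleC[OF L2_fun_monomial, symmetric]
  by (simp add: scaleC_scaleC mult.commute)

lemma cinner_monomial:
  "cinner (monomial m a) (monomial n b) = (if m = n then cinner a b else 0)"
proof -
  have "cinner (monomial m a) (monomial n b) = (\<integral>\<zeta>. \<zeta> ^ m * cnj \<zeta> ^ n * cinner a b \<partial>circle)"
    unfolding monomial_def cinner_abs_L2[OF L2_fun_monomial L2_fun_monomial]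
    by (simp add: cinner_scaleC_left cinner_scaleC_right mult_ac)
  also have "\<dots> = (\<integral>\<zeta>. \<zeta> ^ m * cnj \<zeta> ^ n \<partial>circle) * cinner a b"
    by simp
  finally show ?thesis by (simp add: integral_circle_moment)
qed

lemma norm_sum_monomial:
  assumes "finite A"
  shows "(norm (\<Sum>n\<in>A. monomial n (a n)))\<^sup>2 = (\<Sum>n\<in>A. (norm (a n))\<^sup>2)"
proof -
  have "complex_of_real ((norm (\<Sum>n\<in>A. monomial n (a n)))\<^sup>2)
      = (\<Sum>n\<in>A. \<Sum>m\<in>A. if m = n then cinner (a m) (a n) else 0)"
    by (simp only: cinner_self[symmetric] cinner_sum_left cinner_sum_right cinner_monomial)
  also have "\<dots> = (\<Sum>n\<in>A. cinner (a n) (a n))"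
    using assms by (intro sum.cong) (simp_all add: sum.delta)
  also have "\<dots> = complex_of_real (\<Sum>n\<in>A. (norm (a n))\<^sup>2)"
    by (simp only: cinner_self of_real_sum)
  finally show ?thesis by (simp only: of_real_eq_iff)
qed

lemma abs_L2_polynomial:
  "(\<lambda>\<zeta>. \<Sum>n<N. \<zeta> ^ n *\<^sub>C a n) \<in> L2_fun
    \<and> abs_L2 (\<lambda>\<zeta>. \<Sum>n<N. \<zeta> ^ n *\<^sub>C a n) = (\<Sum>n<N. monomial n (a n))"
  by (induction N) (simp_all add: L2_fun_zero abs_L2_zero L2_fun_add L2_fun_monomial abs_L2_add monomial_def)

text \<open>Pythagoras equates the squared norm of a block of the series with the same block of the
  scalar series, so the Cauchy criterion transfers; completeness of \<open>L2\<close> supplies the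
  limit.\<close>

lemma summable_monomial:
  fixes a :: "nat \<Rightarrow> 'e :: separable_chilbert"
  assumes "summable (\<lambda>n. (norm (a n))\<^sup>2)"
  shows "summable (\<lambda>n. monomial n (a n))"
  unfolding summable_Cauchy
proof (intro allI impI)
  fix e :: real assume e: "0 < e"
  then obtain N where N: "\<And>m n. m \<ge> N \<Longrightarrow> norm (\<Sum>i=m..<n. (norm (a i))\<^sup>2) < e\<^sup>2"
    using assms unfolding summable_Cauchy by (metis zero_less_power)
  have "norm (\<Sum>i=m..<n. monomial i (a i)) < e" if "m \<ge> N" for m n
    using N[OF that, of n] e
    by (intro power2_less_imp_less[of _ e]) (auto simp: norm_sum_monomial sum_nonneg)
  then show "\<exists>N. \<forall>m\<ge>N. \<forall>n. norm (\<Sum>i=m..<n. monomial i (a i)) < e"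
    by blast
qed

text \<open>Pythagoras on the block \<open>{N..<M}\<close>, followed by letting \<open>M\<close>
  tend to infinity. The bound involves only the norms of the coefficients, which later makes it
  uniform in the radius of dilation.\<close>

lemma norm_sum_monomial_tail:
  assumes g: "(\<lambda>n. monomial n (a n)) sums g"
    and a: "summable (\<lambda>n. (norm (a n))\<^sup>2)"
  shows "(norm (g - (\<Sum>n<N. monomial n (a n))))\<^sup>2
    \<le> (\<Sum>n. (norm (a n))\<^sup>2) - (\<Sum>n<N. (norm (a n))\<^sup>2)"
proof (rule tendsto_le)
  show "(\<lambda>M. (norm ((\<Sum>n<M. monomial n (a n)) - (\<Sum>n<N. monomial n (a n))))\<^sup>2)
      \<longlonglongrightarrow> (norm (g - (\<Sum>n<N. monomial n (a n))))\<^sup>2"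
    using g unfolding sums_def by (intro tendsto_intros)
  show "(\<lambda>M. (\<Sum>n<M. (norm (a n))\<^sup>2) - (\<Sum>n<N. (norm (a n))\<^sup>2))
      \<longlonglongrightarrow> (\<Sum>n. (norm (a n))\<^sup>2) - (\<Sum>n<N. (norm (a n))\<^sup>2)"
    by (intro tendsto_intros summable_LIMSEQ a)
  show "\<forall>\<^sub>F M in sequentially. (norm ((\<Sum>n<M. monomial n (a n)) - (\<Sum>n<N. monomial n (a n))))\<^sup>2
      \<le> (\<Sum>n<M. (norm (a n))\<^sup>2) - (\<Sum>n<N. (norm (a n))\<^sup>2)"
    using eventually_ge_at_top[of N]
  proof eventually_elim
    case (elim M)
    have diff: "sum f {..<M} - sum f {..<N} = sum f {N..<M}" for f :: "nat \<Rightarrow> 'x :: ab_group_add"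
      using sum_diff_nat_ivl[of 0 N M f] elim by (simp add: atLeast0LessThan)
    show ?case by (simp add: diff norm_sum_monomial)
  qed
qed simp

section \<open>Boundary values of Hardy functions as monomial series\<close>

lemma square_summable_bounded:
  fixes a :: "nat \<Rightarrow> 'e :: real_normed_vector"
  assumes "summable (\<lambda>n. (norm (a n))\<^sup>2)"
  obtains K where "\<And>n. norm (a n) \<le> K"
proof -
  have "(norm (a n))\<^sup>2 \<le> (\<Sum>n. (norm (a n))\<^sup>2)" for n
    using sum_le_suminf[OF assms, of "{n}"] by simp
  then show ?thesis
    using that real_le_rsqrt by blast
qed

text \<open>For fixed \<open>r < 1\<close> the power series converges uniformly on the circle of
  radius \<open>r\<close>, with majorant \<open>r ^ n * K\<close>, and uniform convergence implies
  \<open>L2\<close> convergence.\<close>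

lemma dilate_sums_monomial:
  fixes f :: "complex \<Rightarrow> 'e :: separable_chilbert"
  assumes a: "summable (\<lambda>n. (norm (a n))\<^sup>2)"
    and f: "\<And>z. z \<in> ball 0 1 \<Longrightarrow> (\<lambda>n. z ^ n *\<^sub>C a n) sums f z"
    and r: "0 \<le> r" "r < 1"
  shows "(\<lambda>n. monomial n (complex_of_real r ^ n *\<^sub>C a n)) sums abs_L2 (\<lambda>\<zeta>. f (complex_of_real r * \<zeta>))"
proof -
  obtain K where K: "\<And>n. norm (a n) \<le> K" using square_summable_bounded[OF a] by blast
  have sm: "summable (\<lambda>n. r ^ n * K)"
    using r by (intro summable_mult2 summable_geometric) auto
  let ?p = "\<lambda>N \<zeta>. \<Sum>n<N. \<zeta> ^ n *\<^sub>C complex_of_real r ^ n *\<^sub>C a n"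
  let ?f = "\<lambda>\<zeta>. f (complex_of_real r * \<zeta>)"
  \<comment> \<open>The tail of the majorant. Its nonnegativity is read off below from the error
    bound at the point 1 of the circle.\<close>
  let ?c = "\<lambda>N. (\<Sum>n. r ^ n * K) - (\<Sum>n<N. r ^ n * K)"
  have "f \<in> hardy_disc" using a f by (auto simp: hardy_disc_def)
  then have fL: "?f \<in> L2_fun" using r by (rule hardy_disc_dilate)
  have bound: "norm (?f \<zeta> - ?p N \<zeta>) \<le> ?c N" if \<zeta>: "norm \<zeta> = 1" for N \<zeta>
  proof -
    let ?t = "\<lambda>n. \<zeta> ^ n *\<^sub>C complex_of_real r ^ n *\<^sub>C a n"
    have t: "?t sums ?f \<zeta>"
      using f[of "complex_of_real r * \<zeta>"] \<zeta> r
      by (simp add: norm_mult scaleC_scaleC power_mult_distrib mult.commute)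
    have "?f \<zeta> - ?p N \<zeta> = (\<Sum>n. ?t (n + N))"
      using suminf_minus_initial_segment[OF sums_summable[OF t], of N] sums_unique[OF t] by simp
    also have "norm \<dots> \<le> (\<Sum>n. r ^ (n + N) * K)"
    proof (rule norm_suminf_le)
      show "norm (?t (n + N)) \<le> r ^ (n + N) * K" for n
        using K[of "n + N"] r \<zeta> by (simp add: norm_power mult_left_mono)
      show "summable (\<lambda>n. r ^ (n + N) * K)"
        using summable_ignore_initial_segment[OF sm] .
    qed
    also have "\<dots> = ?c N"
      using suminf_minus_initial_segment[OF sm, of N] by simp
    finally show ?thesis .
  qed
  have "?c \<longlonglongrightarrow> (\<Sum>n. r ^ n * K) - (\<Sum>n. r ^ n * K)"
    by (intro tendsto_intros summable_LIMSEQ sm)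
  then have c: "?c \<longlonglongrightarrow> 0" by simp
  have le: "norm (abs_L2 ?f - (\<Sum>n<N. monomial n (complex_of_real r ^ n *\<^sub>C a n))) \<le> ?c N" for N
  proof -
    have p: "?p N \<in> L2_fun" "abs_L2 (?p N) = (\<Sum>n<N. monomial n (complex_of_real r ^ n *\<^sub>C a n))"
      by (rule conjunct1[OF abs_L2_polynomial], rule conjunct2[OF abs_L2_polynomial])
    have "0 \<le> ?c N" by (rule order_trans[OF norm_ge_zero bound[of 1]]) simp
    then have "norm (abs_L2 (\<lambda>\<zeta>. ?f \<zeta> - ?p N \<zeta>)) \<le> ?c N"
      using bound by (intro norm_abs_L2_le L2_fun_diff fL p(1)) auto
    then show ?thesis by (simp only: abs_L2_diff[OF fL p(1)] p(2))
  qed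
  have "(\<lambda>N. abs_L2 ?f - (\<Sum>n<N. monomial n (complex_of_real r ^ n *\<^sub>C a n))) \<longlonglongrightarrow> 0"
    by (rule Lim_null_comparison[OF always_eventually c]) (rule allI, rule le)
  then have "(\<lambda>N. abs_L2 ?f - (abs_L2 ?f - (\<Sum>n<N. monomial n (complex_of_real r ^ n *\<^sub>C a n))))
      \<longlonglongrightarrow> abs_L2 ?f - 0"
    by (intro tendsto_diff tendsto_const)
  then show ?thesis by (simp add: sums_def)
qed

text \<open>An interchange of limits: the partial sums approximate the dilates uniformly in
  \<open>r\<close>, and each partial sum converges as \<open>r\<close> tends to 1, so the dilates
  converge to \<open>g\<close>.\<close>

lemma monomial_sums_in_H2:
  fixes a :: "nat \<Rightarrow> 'e :: separable_chilbert"
  assumes a: "summable (\<lambda>n. (norm (a n))\<^sup>2)"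
    and g: "(\<lambda>n. monomial n (a n)) sums g"
  shows "g \<in> H2"
proof -
  obtain K where K: "\<And>n. norm (a n) \<le> K" using square_summable_bounded[OF a] by blast
  define f where "f z = (\<Sum>n. z ^ n *\<^sub>C a n)" for z
  have f: "(\<lambda>n. z ^ n *\<^sub>C a n) sums f z" if "z \<in> ball 0 1" for z
    unfolding f_def
  proof (rule summable_sums, rule summable_comparison_test')
    show "summable (\<lambda>n. norm z ^ n * K)"
      using that by (intro summable_mult2 summable_geometric) auto
    show "norm (z ^ n *\<^sub>C a n) \<le> norm z ^ n * K" for n
      using K by (simp add: norm_power mult_left_mono)
  qed
  let ?tail = "\<lambda>N. (\<Sum>n. (norm (a n))\<^sup>2) - (\<Sum>n<N. (norm (a n))\<^sup>2)"
  let ?p = "\<lambda>N r. \<Sum>n<N. monomial n (complex_of_real r ^ n *\<^sub>C a n)"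
  let ?h = "\<lambda>r. abs_L2 (\<lambda>\<zeta>. f (complex_of_real r * \<zeta>))"
  have "uniform_limit {0..<1} ?p ?h sequentially"
  proof (rule uniform_limitI)
    fix e :: real assume "0 < e"
    have "?tail \<longlonglongrightarrow> (\<Sum>n. (norm (a n))\<^sup>2) - (\<Sum>n. (norm (a n))\<^sup>2)"
      by (intro tendsto_intros summable_LIMSEQ a)
    then have "\<forall>\<^sub>F N in sequentially. ?tail N < e\<^sup>2"
      using \<open>0 < e\<close> by (intro order_tendstoD(2)) auto
    then show "\<forall>\<^sub>F N in sequentially. \<forall>r\<in>{0..<1}. dist (?p N r) (?h r) < e"
    proof eventually_elim
      case (elim N)
      show ?case
      proof
        fix r :: real assume r: "r \<in> {0..<1}"
        let ?b = "\<lambda>n. complex_of_real r ^ n *\<^sub>C a n"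
        \<comment> \<open>Dilation only shrinks the coefficients, so the tail of the dilated series
          is at most \<open>?tail N\<close>, which does not depend on \<open>r\<close>.\<close>
        have le: "(norm (?b n))\<^sup>2 \<le> (norm (a n))\<^sup>2" for n
          using r by (intro power_mono) (auto simp: norm_power intro!: mult_left_le_one_le power_le_one)
        have b: "summable (\<lambda>n. (norm (?b n))\<^sup>2)"
          by (rule summable_comparison_test'[OF a]) (use le in simp)
        have "(norm (?h r - ?p N r))\<^sup>2 \<le> (\<Sum>n. (norm (?b n))\<^sup>2) - (\<Sum>n<N. (norm (?b n))\<^sup>2)"
          using r by (intro norm_sum_monomial_tail dilate_sums_monomial[OF a f] b) auto
        also have "\<dots> = (\<Sum>n. (norm (?b (n + N)))\<^sup>2)"
          by (rule suminf_minus_initial_segment[OF b, symmetric])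
        also have "\<dots> \<le> (\<Sum>n. (norm (a (n + N)))\<^sup>2)"
          by (intro suminf_le le summable_ignore_initial_segment a b summable_ignore_initial_segment[OF b])
        also have "\<dots> = ?tail N"
          by (rule suminf_minus_initial_segment[OF a])
        finally have "(norm (?h r - ?p N r))\<^sup>2 < e\<^sup>2" using elim by simp
        then have "norm (?h r - ?p N r) < e"
          by (rule power2_less_imp_less) (use \<open>0 < e\<close> in simp)
        then show "dist (?p N r) (?h r) < e"
          by (simp add: dist_norm norm_minus_commute)
      qed
    qed
  qed
  moreover have "(?p N \<longlongrightarrow> (\<Sum>n<N. monomial n (a n))) (at_left 1)" for N
  proof -
    have "((\<lambda>r. \<Sum>n<N. complex_of_real r ^ n *\<^sub>C monomial n (a n))
        \<longlongrightarrow> (\<Sum>n<N. complex_of_real 1 ^ n *\<^sub>C monomial n (a n))) (at_left 1)"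
      by (intro tendsto_sum bounded_bilinear.tendsto[OF bounded_bilinear_scaleC] tendsto_intros)
    then show ?thesis by (simp add: monomial_scaleC)
  qed
  ultimately have "(?h \<longlongrightarrow> g) (at_left 1)"
    using g unfolding sums_def
    by (intro swap_uniform_limit'[where f = ?p and F = sequentially and S = "{0..<1}"])
       (auto intro: eventually_mono[OF eventually_dilate])
  then have "boundary_value f g"
    by (simp add: boundary_value_def)
  moreover have "f \<in> hardy_disc" using a f by (auto simp: hardy_disc_def)
  ultimately show ?thesis by (auto simp: H2_def)
qed

lemma monomial_in_H2: "monomial n b \<in> H2"
proof (rule monomial_sums_in_H2)
  let ?a = "\<lambda>m. if m = n then b else 0"
  show "summable (\<lambda>m. (norm (?a m))\<^sup>2)"
    by (rule summable_finite[of "{n}"]) auto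
  have z: "monomial m 0 = (0 :: 'a L2)" for m
    by (simp add: monomial_def abs_L2_zero)
  have "(\<lambda>m. monomial m (?a m)) sums (\<Sum>m\<in>{n}. monomial m (?a m))"
    by (rule sums_finite) (auto simp: z)
  then show "(\<lambda>m. monomial m (?a m)) sums monomial n b" by simp
qed

text \<open>Orthogonality passes from the monomials to the dilates through their series, and from
  the dilates to the boundary value by continuity.\<close>

lemma cinner_H2_eq_0:
  assumes u: "\<And>n b. cinner u (monomial n b) = 0" and h: "h \<in> H2"
  shows "cinner u h = 0"
proof -
  obtain f a where f: "boundary_value f h" "summable (\<lambda>n. (norm (a n))\<^sup>2)"
    "\<And>z. z \<in> ball 0 1 \<Longrightarrow> (\<lambda>n. z ^ n *\<^sub>C a n) sums f z"
    using h by (auto simp: H2_def hardy_disc_def)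
  let ?h = "\<lambda>r. abs_L2 (\<lambda>\<zeta>. f (complex_of_real r * \<zeta>))"
  have "cinner u (?h r) = 0" if r: "0 \<le> r" "r < 1" for r
  proof -
    have "(\<lambda>N. cinner u (\<Sum>n<N. monomial n (complex_of_real r ^ n *\<^sub>C a n))) \<longlonglongrightarrow> cinner u (?h r)"
      using dilate_sums_monomial[OF f(2,3) r] unfolding sums_def by (intro tendsto_intros)
    then show ?thesis by (simp add: cinner_sum_right u LIMSEQ_const_iff)
  qed
  then have "\<forall>\<^sub>F r in at_left 1. cinner u (?h r) = 0"
    using eventually_dilate by (auto elim: eventually_mono)
  moreover have "((\<lambda>r. cinner u (?h r)) \<longlongrightarrow> cinner u h) (at_left 1)"
    using f(1) unfolding boundary_value_def by (intro tendsto_intros)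
  ultimately show ?thesis
    by (metis tendsto_eventually tendsto_unique trivial_limit_at_left_real)
qed

section \<open>Vector-valued Fourier coefficients and existence of the projection\<close>

definition fourier_coeff :: "'e L2 \<Rightarrow> nat \<Rightarrow> 'e :: separable_chilbert" where
  "fourier_coeff u n = (\<integral>\<zeta>. cnj \<zeta> ^ n *\<^sub>C rep_L2 u \<zeta> \<partial>circle)"

text \<open>Pairing with \<open>b\<close> is bounded and linear, hence commutes with the
  vector-valued integral. The coefficient is thus the vector that represents all pairings of
  \<open>u\<close> with monomials of degree \<open>n\<close>.\<close>

lemma cinner_monomial_right: "cinner u (monomial n b) = cinner (fourier_coeff u n) b"
proof -
  have "(\<lambda>\<zeta>. cnj \<zeta> ^ n) \<in> borel_measurable circle"
    by (intro measurable_compose[OF measurable_coord] borel_measurable_continuous_onI continuous_intros)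
  then have L: "(\<lambda>\<zeta>. cnj \<zeta> ^ n *\<^sub>C rep_L2 u \<zeta>) \<in> L2_fun"
    by (intro L2_fun_scaleC_bounded[where K = 1]) (auto simp: rep_L2_in norm_power)
  have "cinner u (monomial n b) = (\<integral>\<zeta>. cinner (cnj \<zeta> ^ n *\<^sub>C rep_L2 u \<zeta>) b \<partial>circle)"
    unfolding monomial_def
    by (subst abs_rep_L2[symmetric], subst cinner_abs_L2)
       (auto simp: rep_L2_in L2_fun_monomial cinner_scaleC_left cinner_scaleC_right)
  also have "\<dots> = cinner (fourier_coeff u n) b"
    unfolding fourier_coeff_def
    by (intro integral_bounded_linear[OF bounded_linear_cinner_left] L2_fun_integrable L)
  finally show ?thesis .
qed

text \<open>For the partial Fourier sum \<open>s\<close> the number \<open>cinner u s\<close> equals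
  the squared norm of \<open>s\<close>, so Cauchy-Schwarz gives
  \<open>norm s \<le> norm u\<close>.\<close>

lemma bessel: "(\<Sum>n<N. (norm (fourier_coeff u n))\<^sup>2) \<le> (norm u)\<^sup>2"
proof -
  define s where "s = (\<Sum>n<N. monomial n (fourier_coeff u n))"
  have s: "(norm s)\<^sup>2 = (\<Sum>n<N. (norm (fourier_coeff u n))\<^sup>2)"
    unfolding s_def by (simp add: norm_sum_monomial)
  have "cinner u s = complex_of_real ((norm s)\<^sup>2)"
    unfolding s by (simp add: s_def cinner_sum_right cinner_monomial_right cinner_self)
  then have "(norm s)\<^sup>2 \<le> norm u * norm s"
    using norm_cinner_le[of u s] by (simp add: norm_power)
  then have "norm s \<le> norm u"
    by (cases "norm s = 0") (auto simp: power2_eq_square)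
  then show ?thesis
    unfolding s[symmetric] by (intro power_mono) auto
qed

text \<open>The projection is written down as a series: by Bessel the coefficients of nonnegative
  index are square summable, their monomial series lies in \<open>H2\<close>, and the remainder is
  orthogonal to every monomial.\<close>

lemma H2_projection:
  fixes u :: "'e :: separable_chilbert L2"
  obtains p where "p \<in> H2" "\<And>h. h \<in> H2 \<Longrightarrow> cinner (u - p) h = 0"
proof -
  let ?a = "fourier_coeff u"
  have a: "summable (\<lambda>n. (norm (?a n))\<^sup>2)"
  proof (rule bounded_imp_summable[where B = "(norm u)\<^sup>2"])
    show "(\<Sum>k\<le>n. (norm (?a k))\<^sup>2) \<le> (norm u)\<^sup>2" for n
      using bessel[of u "Suc n"] by (simp only: lessThan_Suc_atMost)
  qed simp
  define p where "p = (\<Sum>n. monomial n (?a n))"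
  have p: "(\<lambda>n. monomial n (?a n)) sums p"
    unfolding p_def using a by (intro summable_sums summable_monomial)
  have "cinner (u - p) (monomial m b) = 0" for m b
  proof -
    have "(\<lambda>N. cinner (\<Sum>n<N. monomial n (?a n)) (monomial m b)) \<longlonglongrightarrow> cinner p (monomial m b)"
      using p unfolding sums_def by (intro tendsto_intros)
    \<comment> \<open>Once \<open>N\<close> exceeds \<open>m\<close> the pairing sees only the term
      of index \<open>m\<close>, so the sequence is eventually constant.\<close>
    moreover have "cinner (\<Sum>n<N. monomial n (?a n)) (monomial m b) = cinner (?a m) b" if "N > m" for N
      using that by (simp add: cinner_sum_left cinner_monomial)
    then have "\<forall>\<^sub>F N in sequentially.
        cinner (\<Sum>n<N. monomial n (?a n)) (monomial m b) = cinner (?a m) b"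
      by (auto intro: eventually_mono[OF eventually_gt_at_top[of m]])
    then have "(\<lambda>N. cinner (\<Sum>n<N. monomial n (?a n)) (monomial m b)) \<longlonglongrightarrow> cinner (?a m) b"
      by (rule tendsto_eventually)
    ultimately have "cinner p (monomial m b) = cinner (?a m) b"
      by (rule LIMSEQ_unique)
    then show ?thesis unfolding cinner_diff_left cinner_monomial_right[of u] by simp
  qed
  with that[of p] monomial_sums_in_H2[OF a p] cinner_H2_eq_0 show ?thesis by blast
qed

text \<open>Existence and uniqueness justify the definite description in \<open>orth_proj\<close>:
  two candidates differ by an element of \<open>H2\<close> that is orthogonal to itself.\<close>

lemma
  shows orth_proj_H2_in: "orth_proj H2 u \<in> H2"
    and cinner_orth_proj_H2: "h \<in> H2 \<Longrightarrow> cinner (orth_proj H2 u) h = cinner u h"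
proof -
  have "\<exists>!p. p \<in> H2 \<and> (\<forall>h\<in>H2. cinner (u - p) h = 0)"
  proof (rule ex_ex1I)
    show "\<exists>p. p \<in> H2 \<and> (\<forall>h\<in>H2. cinner (u - p) h = 0)"
      using H2_projection[of u] by metis
    fix p q assume p: "p \<in> H2 \<and> (\<forall>h\<in>H2. cinner (u - p) h = 0)"
      and q: "q \<in> H2 \<and> (\<forall>h\<in>H2. cinner (u - q) h = 0)"
    then have "cinner (u - q) (p - q) - cinner (u - p) (p - q) = 0"
      using H2_diff[of p q] by simp
    then have "cinner (p - q) (p - q) = 0"
      by (simp add: cinner_diff_left)
    then show "p = q" by (simp add: cinner_self_eq_0_iff)
  qed
  from theI'[OF this] have *: "orth_proj H2 u \<in> H2" "\<forall>h\<in>H2. cinner (u - orth_proj H2 u) h = 0"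
    unfolding orth_proj_def by auto
  then show "orth_proj H2 u \<in> H2" "h \<in> H2 \<Longrightarrow> cinner (orth_proj H2 u) h = cinner u h"
    by (auto simp: cinner_diff_left)
qed


section \<open>Uniqueness of Fourier coefficients\<close>

lemma measurable_cnj_coord [measurable]: "cnj \<in> borel_measurable circle"
  by (intro measurable_compose[OF measurable_coord] borel_measurable_continuous_onI continuous_intros)

lemma measurable_circle_borel: "f \<in> borel_measurable borel \<Longrightarrow> f \<in> borel_measurable circle"
  using measurable_compose[OF measurable_coord] by blast

lemma integrable_mult_bounded:
  fixes \<phi> g :: "complex \<Rightarrow> complex"
  assumes \<phi>: "integrable circle \<phi>" and g: "g \<in> borel_measurable circle"
    and K: "\<And>\<zeta>. norm \<zeta> = 1 \<Longrightarrow> norm (g \<zeta>) \<le> K"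
  shows "integrable circle (\<lambda>\<zeta>. \<phi> \<zeta> * g \<zeta>)"
proof (rule Bochner_Integration.integrable_bound)
  show "integrable circle (\<lambda>\<zeta>. K *\<^sub>R norm (\<phi> \<zeta>))" using \<phi> by simp
  show "AE \<zeta> in circle. norm (\<phi> \<zeta> * g \<zeta>) \<le> norm (K *\<^sub>R norm (\<phi> \<zeta>))"
  proof (rule AE_I2)
    fix \<zeta> :: complex assume "\<zeta> \<in> space circle"
    then have "norm (g \<zeta>) \<le> \<bar>K\<bar>" using K[of \<zeta>] by simp
    then show "norm (\<phi> \<zeta> * g \<zeta>) \<le> norm (K *\<^sub>R norm (\<phi> \<zeta>))"
      by (simp add: norm_mult abs_mult mult.commute[of "norm (\<phi> \<zeta>)"] mult_right_mono)
  qed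
qed (use \<phi> g in measurable)

text \<open>On the circle the products \<open>\<zeta> ^ m * cnj \<zeta> ^ n\<close> run through all
  integer powers, so every Fourier coefficient vanishes. With two natural exponents the property is
  visibly stable under multiplication by \<open>\<zeta>\<close> and by
  \<open>cnj \<zeta>\<close>.\<close>

definition zero_moments :: "(complex \<Rightarrow> complex) \<Rightarrow> bool" where
  "zero_moments \<phi> \<longleftrightarrow> integrable circle \<phi> \<and> (\<forall>m n. (\<integral>\<zeta>. \<phi> \<zeta> * (\<zeta> ^ m * cnj \<zeta> ^ n) \<partial>circle) = 0)"

lemma zero_moments_integrable: "zero_moments \<phi> \<Longrightarrow> integrable circle \<phi>"
  by (simp add: zero_moments_def)

lemma zero_moments_integrable_moment:
  assumes "zero_moments \<phi>"
  shows "integrable circle (\<lambda>\<zeta>. \<phi> \<zeta> * (\<zeta> ^ m * cnj \<zeta> ^ n))"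
  by (rule integrable_mult_bounded[where K = 1])
     (use assms in \<open>auto simp: zero_moments_def norm_mult norm_power\<close>)

lemma zero_moments_lincomb:
  assumes "zero_moments \<phi>" "zero_moments \<psi>"
  shows "zero_moments (\<lambda>\<zeta>. c * \<phi> \<zeta> + d * \<psi> \<zeta>)"
  unfolding zero_moments_def
proof (intro conjI allI)
  show "integrable circle (\<lambda>\<zeta>. c * \<phi> \<zeta> + d * \<psi> \<zeta>)"
    using assms by (simp add: zero_moments_def)
  fix m n
  have "(\<integral>\<zeta>. c * (\<phi> \<zeta> * (\<zeta> ^ m * cnj \<zeta> ^ n)) + d * (\<psi> \<zeta> * (\<zeta> ^ m * cnj \<zeta> ^ n)) \<partial>circle) = 0"
    using assms zero_moments_integrable_moment[OF assms(1), of m n]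
      zero_moments_integrable_moment[OF assms(2), of m n]
    by (simp add: zero_moments_def)
  then show "(\<integral>\<zeta>. (c * \<phi> \<zeta> + d * \<psi> \<zeta>) * (\<zeta> ^ m * cnj \<zeta> ^ n) \<partial>circle) = 0"
    by (simp add: distrib_right mult.assoc)
qed

lemma zero_moments_mult_coord:
  assumes "zero_moments \<phi>"
  shows "zero_moments (\<lambda>\<zeta>. \<phi> \<zeta> * \<zeta>)" "zero_moments (\<lambda>\<zeta>. \<phi> \<zeta> * cnj \<zeta>)"
proof -
  have "(\<integral>\<zeta>. \<phi> \<zeta> * (\<zeta> ^ Suc m * cnj \<zeta> ^ n) \<partial>circle) = 0"
    "(\<integral>\<zeta>. \<phi> \<zeta> * (\<zeta> ^ m * cnj \<zeta> ^ Suc n) \<partial>circle) = 0" for m n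
    using assms unfolding zero_moments_def by blast+
  then show "zero_moments (\<lambda>\<zeta>. \<phi> \<zeta> * \<zeta>)" "zero_moments (\<lambda>\<zeta>. \<phi> \<zeta> * cnj \<zeta>)"
    using zero_moments_integrable_moment[OF assms, of 1 0] zero_moments_integrable_moment[OF assms, of 0 1]
    by (simp_all add: zero_moments_def mult_ac)
qed

text \<open>The induction keeps \<open>\<phi>\<close> arbitrary: for a product, the hypothesis for
  one factor is applied to the function already multiplied by the other.\<close>

lemma zero_moments_mult_polynomial:
  assumes "real_polynomial_function q" "zero_moments \<phi>"
  shows "zero_moments (\<lambda>\<zeta>. \<phi> \<zeta> * complex_of_real (q \<zeta>))"
  using assms
proof (induction arbitrary: \<phi>)
  case (linear q)
  interpret q: bounded_linear q by fact
  \<comment> \<open>Every real-linear functional on the plane is \<open>2 * Re (c * \<zeta>)\<close>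
    for this \<open>c\<close>, hence a combination of the coordinate and its conjugate.\<close>
  define c where "c = Complex (q 1 / 2) (- q \<i> / 2)"
  have "complex_of_real (q \<zeta>) = c * \<zeta> + cnj c * cnj \<zeta>" for \<zeta>
  proof -
    have "q \<zeta> = q (Re \<zeta> *\<^sub>R 1 + Im \<zeta> *\<^sub>R \<i>)"
      by (rule arg_cong[of _ _ q]) (simp add: complex_eq_iff)
    also have "\<dots> = Re \<zeta> * q 1 + Im \<zeta> * q \<i>"
      by (simp add: q.add q.scaleR)
    finally show ?thesis by (simp add: complex_eq_iff c_def field_simps)
  qed
  then have "(\<lambda>\<zeta>. \<phi> \<zeta> * complex_of_real (q \<zeta>)) = (\<lambda>\<zeta>. c * (\<phi> \<zeta> * \<zeta>) + cnj c * (\<phi> \<zeta> * cnj \<zeta>))"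
    by (simp add: algebra_simps)
  then show ?case
    using zero_moments_lincomb[OF zero_moments_mult_coord[OF linear(2)], of c "cnj c"] by simp
next
  case (const c)
  then show ?case
    using zero_moments_lincomb[OF const const, of "complex_of_real c" 0] by (simp add: mult.commute)
next
  case (add p q)
  then show ?case
    using zero_moments_lincomb[OF add.IH[OF add.prems], of 1 1] by (simp add: distrib_left)
next
  case (mult p q)
  then show ?case
    using mult.IH(2)[OF mult.IH(1)[OF mult.prems]] by (simp add: mult.assoc)
qed

text \<open>Stone-Weierstrass replaces \<open>f\<close> on the circle, up to \<open>e\<close>, by a
  polynomial against which \<open>\<phi>\<close> integrates to zero; the error is at most
  \<open>e\<close> times the \<open>L1\<close> norm of \<open>\<phi>\<close>.\<close>

lemma zero_moments_continuous:
  assumes \<phi>: "zero_moments \<phi>" and f: "continuous_on UNIV f"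
  shows "(\<integral>\<zeta>. \<phi> \<zeta> * complex_of_real (f \<zeta>) \<partial>circle) = 0"
proof -
  let ?I = "\<integral>\<zeta>. \<phi> \<zeta> * complex_of_real (f \<zeta>) \<partial>circle"
  let ?N = "\<integral>\<zeta>. norm (\<phi> \<zeta>) \<partial>circle"
  have i: "integrable circle \<phi>" using \<phi> by (rule zero_moments_integrable)
  have bd: "norm ?I \<le> e * ?N" if e: "e > 0" for e
  proof -
    obtain q where q: "real_polynomial_function q" "\<And>\<zeta>. \<zeta> \<in> sphere 0 1 \<Longrightarrow> \<bar>f \<zeta> - q \<zeta>\<bar> < e"
      using Stone_Weierstrass_real_polynomial_function[of "sphere 0 1" f e] e
        continuous_on_subset[OF f] by auto
    have qc: "continuous_on UNIV q"
      using q(1) by (simp add: continuous_on_polymonial_function real_polynomial_function_eq)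
    have d: "integrable circle (\<lambda>\<zeta>. \<phi> \<zeta> * complex_of_real (f \<zeta> - q \<zeta>))"
    proof (rule integrable_mult_bounded[OF i])
      show "(\<lambda>\<zeta>. complex_of_real (f \<zeta> - q \<zeta>)) \<in> borel_measurable circle"
        by (intro measurable_circle_borel borel_measurable_continuous_onI continuous_intros f qc)
      show "norm (complex_of_real (f \<zeta> - q \<zeta>)) \<le> e" if "norm \<zeta> = 1" for \<zeta>
        using q(2)[of \<zeta>] that by (simp only: norm_of_real) simp
    qed
    have z: "zero_moments (\<lambda>\<zeta>. \<phi> \<zeta> * complex_of_real (q \<zeta>))"
      by (rule zero_moments_mult_polynomial[OF q(1) \<phi>])
    then have "(\<integral>\<zeta>. \<phi> \<zeta> * complex_of_real (q \<zeta>) * (\<zeta> ^ 0 * cnj \<zeta> ^ 0) \<partial>circle) = 0"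
      unfolding zero_moments_def by blast
    moreover have "?I = (\<integral>\<zeta>. \<phi> \<zeta> * complex_of_real (f \<zeta> - q \<zeta>) + \<phi> \<zeta> * complex_of_real (q \<zeta>) \<partial>circle)"
      by (simp add: algebra_simps)
    ultimately have "?I = (\<integral>\<zeta>. \<phi> \<zeta> * complex_of_real (f \<zeta> - q \<zeta>) \<partial>circle)"
      using Bochner_Integration.integral_add[OF d zero_moments_integrable[OF z]] by simp
    also have "norm \<dots> \<le> (\<integral>\<zeta>. e * norm (\<phi> \<zeta>) \<partial>circle)"
    proof (intro order_trans[OF integral_norm_bound] integral_mono_AE AE_I2)
      fix \<zeta> :: complex assume "\<zeta> \<in> space circle"
      then have "\<bar>f \<zeta> - q \<zeta>\<bar> \<le> e" using q(2)[of \<zeta>] by simp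
      then show "norm (\<phi> \<zeta> * complex_of_real (f \<zeta> - q \<zeta>)) \<le> e * norm (\<phi> \<zeta>)"
        unfolding norm_mult norm_of_real by (subst mult.commute) (rule mult_right_mono, simp_all)
    qed (use d i in auto)
    finally show ?thesis by simp
  qed
  have N: "?N \<ge> 0" by simp
  have "norm ?I \<le> 0 + e" if e: "e > 0" for e
  proof -
    \<comment> \<open>Adding one keeps the denominator positive when the \<open>L1\<close> norm is
      zero.\<close>
    have "norm ?I \<le> (e / (?N + 1)) * ?N"
      using e N by (intro bd divide_pos_pos) linarith+
    also have "\<dots> \<le> (e / (?N + 1)) * (?N + 1)"
      using e N by (intro mult_left_mono) auto
    also have "\<dots> = e" using N by (simp add: add_nonneg_eq_0_iff)
    finally show ?thesis by simp
  qed
  then have "norm ?I \<le> 0" by (rule field_le_epsilon)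
  then show ?thesis by simp
qed

text \<open>The continuous functions \<open>max 0 (1 - real n * infdist \<zeta> C)\<close> decrease
  to the indicator, and \<open>norm (\<phi> \<zeta>)\<close> dominates. The empty set is treated
  apart because \<open>infdist\<close> to it is 0 by convention.\<close>

lemma zero_moments_closed:
  assumes \<phi>: "zero_moments \<phi>" and C: "closed C"
  shows "(\<integral>\<zeta>. \<phi> \<zeta> * complex_of_real (indicator C \<zeta>) \<partial>circle) = 0"
proof (cases "C = {}")
  case False
  let ?f = "\<lambda>n \<zeta>. max 0 (1 - real n * infdist \<zeta> C)"
  have f: "continuous_on UNIV (?f n)" for n
    by (intro continuous_intros continuous_on_infdist)
  have [measurable]: "\<phi> \<in> borel_measurable circle"
    using zero_moments_integrable[OF \<phi>] by simp
  have [measurable]: "?f n \<in> borel_measurable circle" for n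
    by (intro measurable_circle_borel borel_measurable_continuous_onI f)
  have [measurable]: "(indicator C :: complex \<Rightarrow> real) \<in> borel_measurable circle"
    using C by (intro measurable_circle_borel borel_measurable_indicator) auto
  have lim: "(\<lambda>n. ?f n \<zeta>) \<longlonglongrightarrow> indicator C \<zeta>" for \<zeta>
  proof (cases "\<zeta> \<in> C")
    case False
    then have "infdist \<zeta> C > 0"
      using in_closed_iff_infdist_zero[OF C \<open>C \<noteq> {}\<close>, of \<zeta>] infdist_nonneg[of \<zeta> C] by linarith
    then obtain N where N: "1 < real N * infdist \<zeta> C"
      using reals_Archimedean3 by blast
    have "?f n \<zeta> = 0" if "n \<ge> N" for n
    proof -
      have "real N * infdist \<zeta> C \<le> real n * infdist \<zeta> C"
        using that by (intro mult_right_mono) (auto simp: infdist_nonneg)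
      with N show ?thesis by simp
    qed
    then have "\<forall>\<^sub>F n in sequentially. ?f n \<zeta> = 0"
      by (auto simp: eventually_sequentially)
    with False show ?thesis by (simp add: tendsto_eventually)
  qed simp
  have "(\<lambda>n. \<integral>\<zeta>. \<phi> \<zeta> * complex_of_real (?f n \<zeta>) \<partial>circle)
      \<longlonglongrightarrow> (\<integral>\<zeta>. \<phi> \<zeta> * complex_of_real (indicator C \<zeta>) \<partial>circle)"
  proof (rule integral_dominated_convergence[where w = "\<lambda>\<zeta>. norm (\<phi> \<zeta>)"])
    show "AE \<zeta> in circle. (\<lambda>n. \<phi> \<zeta> * complex_of_real (?f n \<zeta>))
        \<longlonglongrightarrow> \<phi> \<zeta> * complex_of_real (indicator C \<zeta>)"
      by (intro AE_I2 tendsto_mult tendsto_const tendsto_of_real lim)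
    show "AE \<zeta> in circle. norm (\<phi> \<zeta> * complex_of_real (?f n \<zeta>)) \<le> norm (\<phi> \<zeta>)" for n
    proof (rule AE_I2)
      fix \<zeta> :: complex
      have "\<bar>?f n \<zeta>\<bar> \<le> 1" by (simp add: infdist_nonneg)
      then show "norm (\<phi> \<zeta> * complex_of_real (?f n \<zeta>)) \<le> norm (\<phi> \<zeta>)"
        unfolding norm_mult norm_of_real by (rule mult_left_le) simp
    qed
    show "integrable circle (\<lambda>\<zeta>. norm (\<phi> \<zeta>))"
      using zero_moments_integrable[OF \<phi>] by simp
  qed measurable
  then show ?thesis
    by (simp only: zero_moments_continuous[OF \<phi> f] LIMSEQ_const_iff)
qed simp

text \<open>Closed sets form an intersection-stable generator of the Borel sets, so vanishing of the
  integrals over them spreads to all Borel sets; a density whose integral over every measurable set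
  is zero vanishes almost everywhere.\<close>

lemma zero_moments_AE_eq_0:
  assumes \<phi>: "zero_moments \<phi>"
  shows "AE \<zeta> in circle. \<phi> \<zeta> = 0"
proof (rule sigma_finite_measure.density_zero)
  show "sigma_finite_measure circle"
    using prob_space_circle by (simp add: prob_space_imp_sigma_finite)
  show i: "integrable circle \<phi>" using \<phi> by (rule zero_moments_integrable)
  have inS: "B \<inter> sphere 0 1 \<in> sets circle" if "B \<in> sets borel" for B
    using that by (auto simp: sets_circle sets_restrict_space)
  have sint: "set_integrable circle B \<phi>" if "B \<in> sets circle" for B
    unfolding set_integrable_def by (intro integrable_mult_indicator that i)
  \<comment> \<open>The moment with both exponents zero; the complement case of the induction
    subtracts from it.\<close>
  have tot: "set_lebesgue_integral circle (sphere 0 1) \<phi> = 0"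
  proof -
    have "(\<integral>\<zeta>. \<phi> \<zeta> * (\<zeta> ^ 0 * cnj \<zeta> ^ 0) \<partial>circle) = 0"
      using \<phi> unfolding zero_moments_def by blast
    then show ?thesis using set_integral_space[OF i] by simp
  qed
  \<comment> \<open>The induction runs over Borel sets of the plane, traced on the circle, because
    \<open>circle\<close> carries the trace sigma-algebra.\<close>
  have main: "set_lebesgue_integral circle (B \<inter> sphere 0 1) \<phi> = 0"
    if "B \<in> sigma_sets UNIV (Collect closed)" for B
  proof -
    have "Int_stable (Collect (closed :: complex set \<Rightarrow> bool))" "Collect closed \<subseteq> Pow (UNIV :: complex set)"
      by (auto simp: Int_stable_def)
    from this that show ?thesis
    proof (induction rule: sigma_sets_induct_disjoint)
      case (basic C)
      have "set_lebesgue_integral circle (C \<inter> sphere 0 1) \<phi>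
          = (\<integral>\<zeta>. \<phi> \<zeta> * complex_of_real (indicator C \<zeta>) \<partial>circle)"
        unfolding set_lebesgue_integral_def
        by (intro Bochner_Integration.integral_cong) (auto simp: indicator_def)
      with zero_moments_closed[OF \<phi>] basic show ?case by simp
    next
      case empty
      show ?case by (simp add: set_lebesgue_integral_def)
    next
      case (compl B)
      then have "B \<inter> sphere 0 1 \<in> sets circle"
        by (intro inS) (simp add: borel_eq_closed)
      moreover have "sphere 0 1 \<in> sets circle" using inS[of UNIV] by simp
      moreover have eq: "(UNIV - B) \<inter> sphere 0 1 = sphere 0 1 - B \<inter> sphere 0 1" by auto
      ultimately have "set_lebesgue_integral circle ((B \<inter> sphere 0 1) \<union> ((UNIV - B) \<inter> sphere 0 1)) \<phi>
          = set_lebesgue_integral circle (B \<inter> sphere 0 1) \<phi>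
            + set_lebesgue_integral circle ((UNIV - B) \<inter> sphere 0 1) \<phi>"
        by (intro set_integral_Un sint) (auto simp only: eq sets.Diff)
      moreover have "(B \<inter> sphere 0 1) \<union> ((UNIV - B) \<inter> sphere 0 1) = sphere 0 1" by auto
      ultimately show ?case using compl tot by simp
    next
      case (union B)
      then have B: "B i \<inter> sphere 0 1 \<in> sets circle" for i
        by (intro inS) (auto simp: borel_eq_closed)
      have "set_lebesgue_integral circle (\<Union>i. B i \<inter> sphere 0 1) \<phi>
          = (\<Sum>i. set_lebesgue_integral circle (B i \<inter> sphere 0 1) \<phi>)"
      proof (rule lebesgue_integral_countable_add)
        show "set_integrable circle (\<Union>i. B i \<inter> sphere 0 1) \<phi>"
          using B by (intro sint sets.countable_UN) blast
        show "(B i \<inter> sphere 0 1) \<inter> (B j \<inter> sphere 0 1) = {}" if "i \<noteq> j" for i j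
          using union(1) that by (auto simp: disjoint_family_on_def)
      qed (rule B)
      then show ?case using union(3) by (simp add: Int_UN_distrib2)
    qed
  qed
  show "set_lebesgue_integral circle A \<phi> = 0" if A: "A \<in> sets circle" for A
  proof -
    obtain B where B: "B \<in> sets borel" "A = B \<inter> sphere 0 1"
      using A by (auto simp: sets_circle sets_restrict_space)
    then have "B \<in> sigma_sets UNIV (Collect closed)" by (simp add: borel_eq_closed)
    from main[OF this] B(2) show ?thesis by simp
  qed
qed


section \<open>The backward shift and Toeplitz operators\<close>

text \<open>The adjoint identity has at most one solution by nondegeneracy, so exhibiting one
  determines the definite description.\<close>

lemma cadjoint_eqI:
  assumes "\<And>x y. cinner (T x) y = cinner x (T' y)"
  shows "cadjoint T = T'"
  unfolding cadjoint_def
proof (rule the_equality)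
  show "\<forall>x y. cinner (T x) y = cinner x (T' y)" using assms by blast
  show "U = T'" if "\<forall>x y. cinner (T x) y = cinner x (U y)" for U
  proof (rule ext, rule cinner_right_eqI)
    show "cinner x (U y) = cinner x (T' y)" for x y
      using that[rule_format, of x y] assms[of x y] by simp
  qed
qed

lemma cinner_hardy: "cinner f g = cinner (Rep_hardy f) (Rep_hardy g)"
  by transfer simp

text \<open>Against a Hardy vector the projection is invisible: matrix coefficients of a compression
  are those of the operator on \<open>L2\<close>.\<close>

lemma cinner_Abs_orth_proj:
  "cinner (Abs_hardy (orth_proj H2 u)) h = cinner u (Rep_hardy h)"
  "cinner h (Abs_hardy (orth_proj H2 u)) = cinner (Rep_hardy h) u"
proof -
  show 1: "cinner (Abs_hardy (orth_proj H2 u)) h = cinner u (Rep_hardy h)"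
    by (simp add: cinner_hardy Abs_hardy_inverse orth_proj_H2_in cinner_orth_proj_H2 Rep_hardy)
  show "cinner h (Abs_hardy (orth_proj H2 u)) = cinner (Rep_hardy h) u"
    using 1 by (metis cinner_commute)
qed

lemma cinner_toeplitz: "cinner (toeplitz \<Phi> f) h = cinner (mult_op \<Phi> (Rep_hardy f)) (Rep_hardy h)"
  unfolding toeplitz_def by (rule cinner_Abs_orth_proj)

lemma cinner_mult_op:
  assumes "\<Phi> \<in> Linf_op"
  shows "cinner (mult_op \<Phi> u) v = (\<integral>\<zeta>. cinner (\<Phi> \<zeta> (rep_L2 u \<zeta>)) (rep_L2 v \<zeta>) \<partial>circle)"
proof -
  have "cinner (mult_op \<Phi> u) v = cinner (mult_op \<Phi> u) (abs_L2 (rep_L2 v))"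
    by (simp add: abs_rep_L2)
  then show ?thesis
    unfolding mult_op_def by (simp add: cinner_abs_L2 Linf_op_mult assms rep_L2_in)
qed

section \<open>Multiplication by the coordinate, its adjoint and its interaction with
  symbols\<close>

lemma cnj_coord_mult_circle: "norm \<zeta> = 1 \<Longrightarrow> \<zeta> * cnj \<zeta> = 1"
  by (simp add: complex_norm_square[symmetric])

lemma Linf_op_cnj_coord: "(\<lambda>\<zeta> x. cnj \<zeta> *\<^sub>C x) \<in> Linf_op"
proof -
  have "onorm (\<lambda>x :: 'a. cnj \<zeta> *\<^sub>C x) \<le> 1" if "\<zeta> \<in> sphere 0 1" for \<zeta>
    using that by (intro onorm_bound) auto
  then show ?thesis
    unfolding Linf_op_def bounded_clinear_def
    by (auto simp: bounded_linear_scaleC scaleC_scaleC mult.commute cinner_scaleC_left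
         intro!: exI[of _ 1] AE_I2)
qed

lemma cinner_mult_coord:
  "cinner (mult_op (\<lambda>\<zeta> x. \<zeta> *\<^sub>C x) u) v = cinner u (mult_op (\<lambda>\<zeta> x. cnj \<zeta> *\<^sub>C x) v)"
proof -
  have "cinner u (mult_op (\<lambda>\<zeta> x. cnj \<zeta> *\<^sub>C x) v)
      = cnj (\<integral>\<zeta>. cinner (cnj \<zeta> *\<^sub>C rep_L2 v \<zeta>) (rep_L2 u \<zeta>) \<partial>circle)"
    by (subst cinner_commute) (simp add: cinner_mult_op Linf_op_cnj_coord)
  also have "\<dots> = (\<integral>\<zeta>. cinner (rep_L2 u \<zeta>) (cnj \<zeta> *\<^sub>C rep_L2 v \<zeta>) \<partial>circle)"
    by (simp add: cinner_commute[of "rep_L2 u _"])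
  finally show ?thesis
    by (simp add: cinner_mult_op Linf_op_coord cinner_scaleC_left cinner_scaleC_right)
qed

text \<open>Values of the symbol commute with the scalar \<open>\<zeta>\<close>, and
  \<open>\<zeta> * cnj \<zeta> = 1\<close> on the circle. The identity symbol yields isometry of the
  shift, a general symbol the Toeplitz identity.\<close>

lemma mult_op_mult_coord:
  assumes \<Phi>: "\<Phi> \<in> Linf_op"
  shows "cinner (mult_op \<Phi> (mult_op (\<lambda>\<zeta> x. \<zeta> *\<^sub>C x) u)) (mult_op (\<lambda>\<zeta> x. \<zeta> *\<^sub>C x) v)
    = cinner (mult_op \<Phi> u) v"
proof -
  have L: "(\<lambda>\<zeta>. \<zeta> *\<^sub>C rep_L2 w \<zeta>) \<in> L2_fun" for w :: "'a L2"
    by (rule Linf_op_mult[OF Linf_op_coord rep_L2_in])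
  have M: "mult_op (\<lambda>\<zeta> x. \<zeta> *\<^sub>C x) w = abs_L2 (\<lambda>\<zeta>. \<zeta> *\<^sub>C rep_L2 w \<zeta>)" for w :: "'a L2"
    by (simp add: mult_op_def)
  have "cinner (mult_op \<Phi> (mult_op (\<lambda>\<zeta> x. \<zeta> *\<^sub>C x) u)) (mult_op (\<lambda>\<zeta> x. \<zeta> *\<^sub>C x) v)
      = (\<integral>\<zeta>. cinner (\<Phi> \<zeta> (\<zeta> *\<^sub>C rep_L2 u \<zeta>)) (\<zeta> *\<^sub>C rep_L2 v \<zeta>) \<partial>circle)"
    by (simp only: M mult_op_abs[OF \<Phi> L] cinner_abs_L2[OF Linf_op_mult[OF \<Phi> L] L])
  also have "\<dots> = (\<integral>\<zeta>. cinner (\<Phi> \<zeta> (rep_L2 u \<zeta>)) (rep_L2 v \<zeta>) \<partial>circle)"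
  proof (rule Bochner_Integration.integral_cong[OF refl])
    fix \<zeta> :: complex assume "\<zeta> \<in> space circle"
    then have \<zeta>: "norm \<zeta> = 1" by simp
    then have "\<Phi> \<zeta> (\<zeta> *\<^sub>C rep_L2 u \<zeta>) = \<zeta> *\<^sub>C \<Phi> \<zeta> (rep_L2 u \<zeta>)"
      using \<Phi> by (simp add: Linf_op_def bounded_clinear_def)
    then show "cinner (\<Phi> \<zeta> (\<zeta> *\<^sub>C rep_L2 u \<zeta>)) (\<zeta> *\<^sub>C rep_L2 v \<zeta>) = cinner (\<Phi> \<zeta> (rep_L2 u \<zeta>)) (rep_L2 v \<zeta>)"
      using cnj_coord_mult_circle[OF \<zeta>]
      by (simp add: cinner_scaleC_left cinner_scaleC_right mult.assoc[symmetric] mult.commute[of "cnj \<zeta>"])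
  qed
  finally show ?thesis by (simp add: cinner_mult_op \<Phi>)
qed

text \<open>The adjoint is exhibited as the compression of multiplication by
  \<open>cnj \<zeta>\<close>. The later facts about the backward shift all rest on this
  identity.\<close>

lemma cinner_shift_left:
  fixes f g :: "'e :: separable_chilbert hardy"
  shows "cinner (shift f) g = cinner f (cadjoint shift g)"
proof -
  define B where
    "B g = Abs_hardy (orth_proj H2 (mult_op (\<lambda>\<zeta> x. cnj \<zeta> *\<^sub>C x) (Rep_hardy g)))" for g :: "'e hardy"
  have B: "cinner (shift f) g = cinner f (B g)" for f g
    unfolding B_def cinner_Abs_orth_proj cinner_hardy[of "shift f"] shift.rep_eq
    by (rule cinner_mult_coord)
  then have "cadjoint shift = B" by (rule cadjoint_eqI)
  with B show ?thesis by simp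
qed

lemma Linf_op_id: "(\<lambda>_ x. x) \<in> (Linf_op :: (complex \<Rightarrow> 'e \<Rightarrow> 'e :: separable_chilbert) set)"
proof -
  have "onorm (\<lambda>x :: 'e. x) \<le> 1" by (rule onorm_bound) auto
  then show ?thesis
    unfolding Linf_op_def bounded_clinear_def by (auto intro!: exI[of _ 1] bounded_linear_ident)
qed

lemma mult_op_id: "mult_op (\<lambda>_ x. x) u = u"
  by (simp add: mult_op_def abs_rep_L2)

lemma cinner_shift_shift: "cinner (shift f) (shift g) = cinner f g"
  using mult_op_mult_coord[OF Linf_op_id, of "Rep_hardy f" "Rep_hardy g"]
  by (simp add: cinner_hardy shift.rep_eq mult_op_id)

lemma backward_shift_shift: "cadjoint shift (shift f) = f"
  by (rule cinner_right_eqI) (simp add: cinner_shift_left[symmetric] cinner_shift_shift)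

text \<open>The Brown-Halmos relation. It makes all summands in the corner of a power of the block
  operator contribute the same vector.\<close>

lemma backward_shift_toeplitz_shift:
  assumes "\<Phi> \<in> Linf_op"
  shows "cadjoint shift (toeplitz \<Phi> (shift f)) = toeplitz \<Phi> f"
proof (rule cinner_right_eqI)
  fix h
  have "cinner (toeplitz \<Phi> (shift f)) (shift h) = cinner (toeplitz \<Phi> f) h"
    by (simp add: cinner_toeplitz shift.rep_eq mult_op_mult_coord[OF assms])
  then have "cinner (shift h) (toeplitz \<Phi> (shift f)) = cinner h (toeplitz \<Phi> f)"
    by (metis cinner_commute)
  then show "cinner h (cadjoint shift (toeplitz \<Phi> (shift f))) = cinner h (toeplitz \<Phi> f)"
    by (simp add: cinner_shift_left)
qed

lemma norm_shift: "norm (shift f) = norm f"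
proof -
  have "(norm (shift f))\<^sup>2 = (norm f)\<^sup>2"
    using cinner_shift_shift[of f f] unfolding cinner_self of_real_eq_iff .
  then show ?thesis by simp
qed

text \<open>Cauchy-Schwarz applied to \<open>cinner (shift ?B) f\<close>, which is the squared norm
  of \<open>?B\<close>; the shift is isometric.\<close>

lemma norm_backward_shift_le: "norm (cadjoint shift f) \<le> norm f"
proof -
  let ?B = "cadjoint shift f"
  have "cinner (shift ?B) f = complex_of_real ((norm ?B)\<^sup>2)"
    unfolding cinner_shift_left by (rule cinner_self)
  then have "(norm ?B)\<^sup>2 \<le> norm ?B * norm f"
    using norm_cinner_le[of "shift ?B" f] by (simp add: norm_shift norm_power)
  then show ?thesis
    by (cases "norm ?B = 0") (auto simp: power2_eq_square)
qed

lemma backward_shift_add: "cadjoint shift (f + g) = cadjoint shift f + cadjoint shift g"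
  by (rule cinner_right_eqI) (simp add: cinner_shift_left[symmetric] cinner_add_right)

lemma backward_shift_scaleC: "cadjoint shift (c *\<^sub>C f) = c *\<^sub>C cadjoint shift f"
  by (rule cinner_right_eqI) (simp add: cinner_shift_left[symmetric] cinner_scaleC_right)

lemma bounded_linear_backward_shift: "bounded_linear (cadjoint shift)"
  by (rule bounded_linear_intro[where K = 1])
     (simp_all add: backward_shift_add norm_backward_shift_le backward_shift_scaleC scaleC_of_real[symmetric])

text \<open>Matrix coefficients between monomials are moments of the scalar functions
  \<open>cinner (\<Phi> \<zeta> x) y\<close>; nonnegative degrees on both sides already produce
  every integer frequency.\<close>

lemma toeplitz_eq_0_imp_symbol_AE_eq_0:
  fixes \<Phi> :: "complex \<Rightarrow> 'e :: separable_chilbert \<Rightarrow> 'e"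
  assumes \<Phi>: "\<Phi> \<in> Linf_op" and T: "\<And>f. toeplitz \<Phi> f = 0"
  shows "AE \<zeta> in circle. \<Phi> \<zeta> = (\<lambda>_. 0)"
proof -
  have lin: "bounded_linear (\<Phi> \<zeta>)" "\<And>c x. \<Phi> \<zeta> (c *\<^sub>C x) = c *\<^sub>C \<Phi> \<zeta> x" if "norm \<zeta> = 1" for \<zeta>
    using \<Phi> that by (auto simp: Linf_op_def bounded_clinear_def)
  have const: "(\<lambda>_. x) \<in> L2_fun" for x :: 'e
    by (rule L2_fun_bounded[where c = "norm x"]) auto
  have AE0: "AE \<zeta> in circle. cinner (\<Phi> \<zeta> x) y = 0" for x y
  proof (rule zero_moments_AE_eq_0)
    have "(\<integral>\<zeta>. cinner (\<Phi> \<zeta> x) y * (\<zeta> ^ m * cnj \<zeta> ^ n) \<partial>circle) = 0" for m n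
    proof -
      have "0 = cinner (toeplitz \<Phi> (Abs_hardy (monomial m x))) (Abs_hardy (monomial n y))"
        by (simp add: T)
      also have "\<dots> = cinner (mult_op \<Phi> (monomial m x)) (monomial n y)"
        by (simp add: cinner_toeplitz Abs_hardy_inverse monomial_in_H2)
      also have "\<dots> = (\<integral>\<zeta>. cinner (\<Phi> \<zeta> (\<zeta> ^ m *\<^sub>C x)) (\<zeta> ^ n *\<^sub>C y) \<partial>circle)"
        by (simp only: monomial_def mult_op_abs[OF \<Phi> L2_fun_monomial]
            cinner_abs_L2[OF Linf_op_mult[OF \<Phi> L2_fun_monomial] L2_fun_monomial])
      also have "\<dots> = (\<integral>\<zeta>. cinner (\<Phi> \<zeta> x) y * (\<zeta> ^ m * cnj \<zeta> ^ n) \<partial>circle)"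
        by (intro Bochner_Integration.integral_cong)
           (auto simp: lin(2) cinner_scaleC_left cinner_scaleC_right mult_ac)
      finally show ?thesis by simp
    qed
    then show "zero_moments (\<lambda>\<zeta>. cinner (\<Phi> \<zeta> x) y)"
      using integrable_cinner[OF Linf_op_mult[OF \<Phi> const] const] by (simp add: zero_moments_def)
  qed
  obtain D :: "'e set" where D: "countable D" "\<And>x. \<exists>X. (\<forall>n. X n \<in> D) \<and> X \<longlonglongrightarrow> x"
    using dense_separable_chilbert by blast
  \<comment> \<open>The exceptional null set in \<open>AE0\<close> depends on \<open>x\<close> and
    \<open>y\<close>; restricting both to a countable set gives a common one.\<close>
  have "AE \<zeta> in circle. \<forall>x\<in>D. \<forall>y\<in>D. cinner (\<Phi> \<zeta> x) y = 0"
    using D(1) AE0 by (simp add: AE_ball_countable)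
  with AE_space show ?thesis
  proof eventually_elim
    case (elim \<zeta>)
    \<comment> \<open>Continuity extends the vanishing first in \<open>y\<close> and then in
      \<open>x\<close>, where boundedness of \<open>\<Phi> \<zeta>\<close> enters.\<close>
    have 1: "cinner (\<Phi> \<zeta> x) y = 0" if "x \<in> D" for x y
    proof -
      obtain Y where Y: "\<And>n. Y n \<in> D" "Y \<longlonglongrightarrow> y" using D(2) by blast
      have "(\<lambda>n. cinner (\<Phi> \<zeta> x) (Y n)) \<longlonglongrightarrow> cinner (\<Phi> \<zeta> x) y"
        by (intro tendsto_intros Y)
      then show ?thesis using elim that Y(1) by (simp add: LIMSEQ_const_iff)
    qed
    have "cinner (\<Phi> \<zeta> x) y = 0" for x y
    proof -
      obtain X where X: "\<And>n. X n \<in> D" "X \<longlonglongrightarrow> x" using D(2) by blast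
      have "(\<lambda>n. cinner (\<Phi> \<zeta> (X n)) y) \<longlonglongrightarrow> cinner (\<Phi> \<zeta> x) y"
        using elim by (intro tendsto_intros bounded_linear.tendsto[OF lin(1)] X) simp
      then show ?thesis using 1 X(1) by (simp add: LIMSEQ_const_iff)
    qed
    then show ?case using cinner_self_eq_0_iff by blast
  qed
qed


section \<open>Similarity to a contraction\<close>

text \<open>Inner factors cancel in powers, leaving one \<open>W\<close> and one \<open>V\<close>
  around a power of a contraction; hence \<open>onorm W * onorm V\<close> serves for every
  \<open>n\<close>.\<close>

lemma similar_to_contraction_power_bounded:
  fixes T :: "'a :: complex_inner \<Rightarrow> 'a"
  assumes "similar_to_contraction T"
  obtains C where "\<And>n x. norm ((T ^^ n) x) \<le> C * norm x"
proof -
  obtain W V :: "'a \<Rightarrow> 'a" where W: "bounded_clinear W" "bounded_clinear V" "W \<circ> V = id"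
    and C: "contraction (V \<circ> T \<circ> W)"
    using assms unfolding similar_to_contraction_def by blast
  define K where "K = V \<circ> T \<circ> W"
  have bl: "bounded_linear W" "bounded_linear V" "bounded_linear K"
    using W C by (auto simp: K_def bounded_clinear_def contraction_def)
  have WV: "W (V x) = x" for x using W(3) by (metis comp_apply id_apply)
  have T: "(T ^^ n) x = W ((K ^^ n) (V x))" for n x
    by (induction n) (simp_all add: WV K_def)
  have Kn: "norm ((K ^^ n) x) \<le> norm x" for n x
  proof (induction n)
    case (Suc n)
    have "norm (K ((K ^^ n) x)) \<le> onorm K * norm ((K ^^ n) x)"
      by (rule onorm[OF bl(3)])
    also have "\<dots> \<le> 1 * norm x"
      using C by (intro mult_mono Suc) (simp_all add: contraction_def K_def)
    finally show ?case by simp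
  qed simp
  have "norm ((T ^^ n) x) \<le> (onorm W * onorm V) * norm x" for n x
  proof -
    have "norm ((T ^^ n) x) \<le> onorm W * norm ((K ^^ n) (V x))"
      unfolding T by (rule onorm[OF bl(1)])
    also have "\<dots> \<le> onorm W * (onorm V * norm x)"
      by (intro mult_left_mono order_trans[OF Kn onorm[OF bl(2)]] onorm_pos_le[OF bl(1)])
    finally show ?thesis by (simp add: mult.assoc)
  qed
  with that show ?thesis by blast
qed

lemma block_upper_power:
  fixes A X S :: "'a :: complex_inner \<Rightarrow> 'a"
  assumes A: "bounded_linear A" and AS: "\<And>f. A (S f) = f" and AXS: "\<And>f. A (X (S f)) = X f"
  shows "(block_upper A X A ^^ n) (0, (S ^^ n) h) = (real n *\<^sub>R X (S h), h)"
proof (induction n arbitrary: h)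
  case (Suc n)
  have "(block_upper A X A ^^ Suc n) (0, (S ^^ Suc n) h)
      = block_upper A X A ((block_upper A X A ^^ n) (0, (S ^^ n) (S h)))"
    \<comment> \<open>One shift is moved inward, so the induction hypothesis is needed at
      \<open>S h\<close>; hence \<open>h\<close> stays arbitrary.\<close>
    by (simp add: funpow_swap1)
  also have "\<dots> = block_upper A X A (real n *\<^sub>R X (S (S h)), S h)"
    by (simp only: Suc.IH)
  \<comment> \<open>Here \<open>A\<close> removes one \<open>S\<close> from each of the
    \<open>n\<close> copies, and the corner entry applied to the second coordinate
    \<open>S h\<close> adds one more.\<close>
  also have "\<dots> = (real (Suc n) *\<^sub>R X (S h), h)"
    by (simp add: block_upper_def linear_simps(5)[OF A] AS AXS scaleR_left_distrib)
  finally show ?case .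
qed simp

lemma norm_funpow_shift: "norm ((shift ^^ n) f) = norm f"
  by (induction n) (simp_all add: norm_shift)

theorem mainTheorem3:
  fixes \<Phi> :: "complex \<Rightarrow> 'e :: separable_chilbert \<Rightarrow> 'e"
  assumes "\<Phi> \<in> Linf_op"
  shows "similar_to_contraction (block_upper (cadjoint shift) (toeplitz \<Phi>) (cadjoint shift))
    \<longleftrightarrow> (AE \<zeta> in circle. \<Phi> \<zeta> = (\<lambda>_. 0))"
proof
  let ?A = "cadjoint shift :: 'e hardy \<Rightarrow> 'e hardy"
  let ?T = "block_upper ?A (toeplitz \<Phi>) ?A"
  assume "similar_to_contraction ?T"
  then obtain C where C: "\<And>n x. norm ((?T ^^ n) x) \<le> C * norm x"
    using similar_to_contraction_power_bounded by blast
  have "toeplitz \<Phi> (shift h) = 0" for h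
  proof (rule ccontr)
    let ?x = "toeplitz \<Phi> (shift h)"
    assume "?x \<noteq> 0"
    \<comment> \<open>The first coordinate grows linearly in \<open>n\<close>, whereas the starting
      vectors keep the norm of \<open>h\<close> because the shift is isometric.\<close>
    then obtain n where n: "C * norm h < real n * norm ?x"
      using reals_Archimedean3[of "norm ?x"] by auto
    have "real n * norm ?x = norm (real n *\<^sub>R ?x)" by simp
    also have "\<dots> \<le> norm (real n *\<^sub>R ?x, h)" by (rule norm_fst_le)
    also have "(real n *\<^sub>R ?x, h) = (?T ^^ n) (0, (shift ^^ n) h)"
      by (rule block_upper_power[where A = ?A and S = shift and X = "toeplitz \<Phi>", symmetric, OF bounded_linear_backward_shift
            backward_shift_shift backward_shift_toeplitz_shift[OF assms]])
    also have "norm \<dots> \<le> C * norm (0 :: 'e hardy, (shift ^^ n) h)" by (rule C)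
    also have "\<dots> = C * norm h" by (simp add: norm_Pair norm_funpow_shift)
    finally show False using n by simp
  qed
  \<comment> \<open>The Toeplitz identity writes \<open>toeplitz \<Phi> h\<close> as the backward
    shift of \<open>toeplitz \<Phi> (shift h)\<close>, which is zero.\<close>
  moreover have "?A 0 = 0" by (rule linear_simps(3)[OF bounded_linear_backward_shift])
  ultimately have "toeplitz \<Phi> h = 0" for h
    using backward_shift_toeplitz_shift[OF assms, of h] by metis
  with assms show "AE \<zeta> in circle. \<Phi> \<zeta> = (\<lambda>_. 0)"
    by (rule toeplitz_eq_0_imp_symbol_AE_eq_0)
next
  let ?A = "cadjoint shift :: 'e hardy \<Rightarrow> 'e hardy"
  assume AE: "AE \<zeta> in circle. \<Phi> \<zeta> = (\<lambda>_. 0)"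
  have M0: "mult_op \<Phi> u = 0" for u
  proof -
    have "AE \<zeta> in circle. \<Phi> \<zeta> (rep_L2 u \<zeta>) = 0"
      using AE by eventually_elim simp
    then show ?thesis
      unfolding mult_op_def abs_L2_zero[symmetric]
      by (subst abs_L2_eq_iff) (auto intro: Linf_op_mult assms rep_L2_in L2_fun_zero)
  qed
  have T0: "toeplitz \<Phi> f = 0" for f
    by (rule cinner_left_eqI) (simp add: cinner_toeplitz M0)
  \<comment> \<open>With a null symbol the block operator is a direct sum of two backward shifts,
    already a contraction, and the identity serves as the similarity.\<close>
  define T where "T = block_upper ?A (toeplitz \<Phi>) ?A"
  have T: "T p = (?A (fst p), ?A (snd p))" for p
    by (simp add: T_def block_upper_def T0 split: prod.split)
  have le: "norm (T p) \<le> norm p" for p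
    unfolding T norm_prod_def
    by (intro real_sqrt_le_mono add_mono power_mono) (auto simp: norm_backward_shift_le)
  have "bounded_linear T"
    by (rule bounded_linear_intro[where K = 1])
       (simp_all add: T le[unfolded T] backward_shift_add linear_simps(5)[OF bounded_linear_backward_shift])
  moreover have "T (c *\<^sub>C p) = c *\<^sub>C T p" for c p
    by (simp add: T scaleC_prod_def backward_shift_scaleC)
  moreover have "onorm T \<le> 1"
    using le by (intro onorm_bound) auto
  ultimately have "contraction T"
    by (simp add: contraction_def bounded_clinear_def)
  then have "contraction (id \<circ> T \<circ> id)" by simp
  moreover have "bounded_clinear (id :: 'e hardy \<times> 'e hardy \<Rightarrow> _)"
    unfolding bounded_clinear_def id_def by (simp add: bounded_linear_ident)
  ultimately show "similar_to_contraction (block_upper ?A (toeplitz \<Phi>) ?A)"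
    unfolding similar_to_contraction_def T_def[symmetric] by (metis comp_id)
qed

end
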